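(* For $k\ge 1$ let $m_k=m(\gamma_k^1)$ be the Markov value of the bi-infinite word $\gamma_k^1$. The sequence $(m_k)_{k\ge 1}$ is decreasing and converges to $3$, and its first four elements $m_1,m_2,m_3,m_4$ belong to $M\setminus L$. Moreover, $m_1,m_2,m_3,m_4$ belong to pairwise distinct connected components of $\mathbb{R}\setminus L$.
   Context: For a bi-infinite sequence $\theta=(a_n)_{n\in\mathbb{Z}}$ of positive integers put $\lambda_i(\theta)=[a_i;a_{i+1},a_{i+2},\dots]+[0;a_{i-1},a_{i-2},\dots]$ (continued fractions) and define its Markov value $m(\theta)=\sup_{i\in\mathbb{Z}}\lambda_i(\theta)$. The Markov spectrum is $M=\{m(\theta)<\infty:\theta\in(\mathbb{N}^* )^{\mathbb{Z}}\}$, where $\mathbb{N}^*=\{1,2,3,\dots\}$, and the Lagrange spectrum $L$ is the closure of the set of Markov values of periodic words in $(\mathbb{N}^* )^{\mathbb{Z}}$. Subscripts indicate repetition of a character, e.g. $1_2 2_4$ is $112222$. For $k\ge 1$ let $\underline{\omega}_k$ be the finite string $2_{2k}\,1_2\,2_{2k+1}\,1_2\,2_{2k+2}\,1_2$. The bi-infinite word $\gamma_k^1=\overline{\underline{\omega}_k}\,\underline{\omega}_k\,\underline{\omega}_k\,\overline{2}$ consists of infinitely many copies of $\underline{\omega}_k$ concatenated to the left, then two further copies of $\underline{\omega}_k$, then infinitely many $2$'s to the right. *)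

theory Defs
  imports "HOL-Analysis.Analysis"
begin

fun cf_convergent :: "(nat \<Rightarrow> nat) \<Rightarrow> nat \<Rightarrow> real" where
  "cf_convergent a 0 = real (a 0)"
| "cf_convergent a (Suc n) = real (a 0) + 1 / cf_convergent (\<lambda>j. a (Suc j)) n"

text \<open>The value \<open>[a 0; a 1, a 2, \<dots>]\<close>. The limit exists whenever \<open>a j\<close> is positive for
  all positive \<open>j\<close>; the integer part \<open>a 0\<close> may be \<open>0\<close>.\<close>

definition contfrac :: "(nat \<Rightarrow> nat) \<Rightarrow> real" where
  "contfrac a = lim (cf_convergent a)"

definition positive_word :: "(int \<Rightarrow> nat) \<Rightarrow> bool" where
  "positive_word \<theta> \<longleftrightarrow> (\<forall>n. \<theta> n \<ge> 1)"

definition lambda_at :: "(int \<Rightarrow> nat) \<Rightarrow> int \<Rightarrow> real" where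
  "lambda_at \<theta> i =
     contfrac (\<lambda>j. \<theta> (i + int j)) + contfrac (\<lambda>j. if j = 0 then 0 else \<theta> (i - int j))"

text \<open>The supremum is taken in the extended reals, since it may be infinite.\<close>

definition markov_value :: "(int \<Rightarrow> nat) \<Rightarrow> ereal" where
  "markov_value \<theta> = (SUP i. ereal (lambda_at \<theta> i))"

definition markov_spectrum :: "real set" where
  "markov_spectrum = {x. \<exists>\<theta>. positive_word \<theta> \<and> markov_value \<theta> = ereal x}"

definition periodic_word :: "(int \<Rightarrow> nat) \<Rightarrow> bool" where
  "periodic_word \<theta> \<longleftrightarrow> (\<exists>p>0. \<forall>n. \<theta> (n + p) = \<theta> n)"

text \<open>Periodic words are bounded, so requiring a finite Markov value here excludes none.\<close>

definition lagrange_spectrum :: "real set" where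
  "lagrange_spectrum =
     closure {x. \<exists>\<theta>. positive_word \<theta> \<and> periodic_word \<theta> \<and> markov_value \<theta> = ereal x}"

text \<open>The bi-infinite word \<open>\<dots>uuu v www\<dots>\<close> with the first letter of \<open>v\<close> at position \<open>0\<close>
  (Markov values do not depend on the choice of origin); \<open>u\<close> and \<open>w\<close> are meant to be
  nonempty.\<close>

definition biinfinite_word :: "nat list \<Rightarrow> nat list \<Rightarrow> nat list \<Rightarrow> int \<Rightarrow> nat" where
  "biinfinite_word u v w n =
     (if n < 0 then u ! nat (n mod int (length u))
      else if n < int (length v) then v ! nat n
      else w ! nat ((n - int (length v)) mod int (length w)))"

definition omega :: "nat \<Rightarrow> nat list" where
  "omega k =
     replicate (2 * k) 2 @ replicate 2 1 @
     replicate (2 * k + 1) 2 @ replicate 2 1 @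
     replicate (2 * k + 2) 2 @ replicate 2 1"

definition gamma1 :: "nat \<Rightarrow> int \<Rightarrow> nat" where
  "gamma1 k = biinfinite_word (omega k) (omega k @ omega k) [2]"

text \<open>The letters of \<open>gamma1 k\<close> are bounded, so its Markov value is finite and
  \<open>real_of_ereal\<close> is an actual conversion here.\<close>

definition m_seq :: "nat \<Rightarrow> real" where
  "m_seq k = real_of_ereal (markov_value (gamma1 k))"

end

theory Submission
  imports Defs
begin

text \<open>
  By the identity \<open>[2; A] + [0; 1, 1, B] = 3 + [0; A] - [0; 2, B]\<close> the values \<open>lambda_at\<close> of a word built
  from the blocks \<open>11\<close> and \<open>2\<^sub>n\<close> exceed \<open>3\<close> only at ends of blocks of \<open>2\<close>s, and in copies of \<open>omega k\<close> the
  largest of them occurs at the first letter of \<open>2\<^bsub>2k+1\<^esub>\<close>. In \<open>gamma1 k\<close> the maximum is attained in the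
  last copy but one; it is slightly larger than the Markov value of the periodic word
  \<open>omega_bar k\<close>, which in turn is larger than \<open>m_seq (Suc k)\<close>. This gives the monotonicity and the limit,
  and points of the Lagrange spectrum that separate the \<open>m_seq k\<close>.

  For \<open>k \<le> 4\<close>, a word whose Markov value is close to \<open>m_seq k\<close> must, up to reflection, agree with
  \<open>gamma1 k\<close> on a long window (local uniqueness), and its part coinciding with \<open>omega_bar k\<close> must be
  repeated one period further to the left (self-replication). A periodic word would then contain it
  also to the right, where \<open>gamma1 k\<close> differs from \<open>omega_bar k\<close>. Both properties are finite searches.
\<close>

text \<open>Parity drives the comparisons: an even number of letters put in front of two tails keeps
  their order, an odd number reverses it. In \<open>gamma1 k\<close> every copy of
  \<open>omega k\<close> has the same periodic word to its left, so its peak depends only on the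
  tail to its right and increases with it. The length of \<open>omega k\<close> is odd, and the tail
  of constant 2s lies below the tail of any word that begins with \<open>omega k\<close>. Hence the
  largest possible right tail is that of one further copy followed by 2s; this singles out the last
  copy but one and makes the excess over \<open>omega_bar k\<close> strict.

  Since \<open>lagrange_spectrum\<close> is a closure, it is not enough that no periodic word has
  the value \<open>m_seq k\<close>: a whole open interval around it, with rational ends
  \<open>offset B\<close> and \<open>offset T\<close>, must be free of such values. Local uniqueness
  uses both ends, self-replication only the upper one. The bound 3.1 on the upper end forces the
  letters 1 and 2, so that the searches branch in two. The search trees are explicit data for each
  single \<open>k\<close>, whereas the statements on monotonicity, limit and separation hold for all
  \<open>k\<close> from 1 on.\<close>

section \<open>Tails of continued fractions\<close>

lemma cf_convergent_ge_1:
  assumes "\<And>j. 1 \<le> a j"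
  shows "1 \<le> cf_convergent a n"
  using assms
proof (induction n arbitrary: a)
  case (Suc n)
  have "1 \<le> cf_convergent (\<lambda>j. a (Suc j)) n"
    by (rule Suc.IH) (rule Suc.prems)
  then have "0 \<le> 1 / cf_convergent (\<lambda>j. a (Suc j)) n" by simp
  moreover have "1 \<le> real (a 0)" using Suc.prems[of 0] by linarith
  ultimately have "1 + 0 \<le> real (a 0) + 1 / cf_convergent (\<lambda>j. a (Suc j)) n" by (rule add_mono[rotated])
  then show ?case by simp
next
  case 0
  then show ?case using 0[of 0] by simp
qed

lemma cf_convergent_diff_le_1:
  assumes "\<And>j. 1 \<le> a (Suc j)"
  shows "\<bar>cf_convergent a n - cf_convergent a m\<bar> \<le> 1"
proof -
  have "real (a 0) \<le> cf_convergent a i \<and> cf_convergent a i \<le> real (a 0) + 1" for i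
  proof (cases i)
    case (Suc j)
    have "1 \<le> cf_convergent (\<lambda>j. a (Suc j)) j" by (rule cf_convergent_ge_1) (rule assms)
    then have "0 \<le> 1 / cf_convergent (\<lambda>j. a (Suc j)) j" "1 / cf_convergent (\<lambda>j. a (Suc j)) j \<le> 1"
      by simp_all
    then show ?thesis unfolding Suc cf_convergent.simps by linarith
  qed simp
  from this[of n] this[of m] show ?thesis by linarith
qed

text \<open>Two steps are taken at once, because a single step \<open>x \<mapsto> b + 1 / x\<close>
  is no uniform contraction near 1. The double step is a Moebius map of determinant 1 whose
  denominators \<open>b * x + 1\<close> are at least 2.\<close>

lemma cf_step_contraction:
  fixes b x y :: real
  assumes "1 \<le> b" "1 \<le> x" "1 \<le> y"
  shows "\<bar>1 / (b + 1 / x) - 1 / (b + 1 / y)\<bar> \<le> \<bar>x - y\<bar> / 4"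
proof -
  have *: "2 \<le> b * x + 1" "2 \<le> b * y + 1"
    using assms mult_mono[of 1 b 1 x] mult_mono[of 1 b 1 y] by auto
  have "1 / (b + 1 / z) = z / (b * z + 1)" if "1 \<le> z" for z
    using that by (simp add: add_divide_eq_iff)
  moreover have "x / (b * x + 1) - y / (b * y + 1) = (x - y) / ((b * x + 1) * (b * y + 1))"
    using * by (subst diff_frac_eq) (auto simp: algebra_simps)
  ultimately have "1 / (b + 1 / x) - 1 / (b + 1 / y) = (x - y) / ((b * x + 1) * (b * y + 1))"
    using assms by simp
  moreover have "\<bar>x - y\<bar> / ((b * x + 1) * (b * y + 1)) \<le> \<bar>x - y\<bar> / 4"
    using * mult_mono[OF *] by (intro divide_left_mono) auto
  ultimately show ?thesis using * by (simp add: abs_mult)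
qed

lemma cf_convergent_Cauchy_bound:
  assumes "\<And>j. 1 \<le> a (Suc j)" "2 * k \<le> n" "2 * k \<le> m"
  shows "\<bar>cf_convergent a n - cf_convergent a m\<bar> \<le> (1 / 4) ^ k"
  using assms
proof (induction k arbitrary: a n m)
  case 0
  then show ?case using cf_convergent_diff_le_1 by auto
next
  case (Suc k)
  define n' m' where "n' = n - 2" and "m' = m - 2"
  with Suc.prems have [simp]: "n = Suc (Suc n')" "m = Suc (Suc m')" by auto
  define c where "c = (\<lambda>j. a (Suc (Suc j)))"
  have c: "\<And>j. 1 \<le> c j" using Suc.prems(1) by (auto simp: c_def)
  have "\<bar>cf_convergent a n - cf_convergent a m\<bar> \<le> \<bar>cf_convergent c n' - cf_convergent c m'\<bar> / 4"
    using cf_step_contraction[of "real (a (Suc 0))" "cf_convergent c n'" "cf_convergent c m'"]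
      Suc.prems(1)[of 0] cf_convergent_ge_1[OF c] by (simp add: c_def)
  also have "\<dots> \<le> (1 / 4) ^ k / 4"
    using Suc.prems(2,3) by (intro divide_right_mono Suc.IH) (auto intro: c[simplified])
  finally show ?case by simp
qed

lemma cf_convergent_LIMSEQ:
  assumes "\<And>j. 1 \<le> a (Suc j)"
  shows "cf_convergent a \<longlonglongrightarrow> contfrac a"
proof -
  have "Cauchy (cf_convergent a)"
    unfolding Cauchy_altdef
  proof (intro allI impI)
    fix e :: real assume "0 < e"
    then obtain k where k: "(1 / 4) ^ k < e" using real_arch_pow_inv[of e "1/4"] by auto
    show "\<exists>M. \<forall>m\<ge>M. \<forall>n>m. dist (cf_convergent a m) (cf_convergent a n) < e"
    proof (intro exI[of _ "2 * k"] allI impI)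
      fix m n assume "2 * k \<le> m" "m < n"
      then have "\<bar>cf_convergent a m - cf_convergent a n\<bar> \<le> (1 / 4) ^ k"
        using assms by (intro cf_convergent_Cauchy_bound) auto
      then show "dist (cf_convergent a m) (cf_convergent a n) < e"
        using k by (simp add: dist_real_def)
    qed
  qed
  then show ?thesis unfolding contfrac_def
    using real_Cauchy_convergent convergent_LIMSEQ_iff by blast
qed

lemma contfrac_ge_1:
  assumes "\<And>j. 1 \<le> a j"
  shows "1 \<le> contfrac a"
proof (rule LIMSEQ_le_const)
  show "cf_convergent a \<longlonglongrightarrow> contfrac a" by (rule cf_convergent_LIMSEQ) (rule assms)
  show "\<exists>N. \<forall>n\<ge>N. 1 \<le> cf_convergent a n" using cf_convergent_ge_1[of a, OF assms] by simp
qed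

lemma contfrac_rec:
  assumes "\<And>j. 1 \<le> a (Suc j)"
  shows "contfrac a = real (a 0) + 1 / contfrac (\<lambda>j. a (Suc j))"
proof -
  have "(\<lambda>n. cf_convergent a (Suc n)) \<longlonglongrightarrow> real (a 0) + 1 / contfrac (\<lambda>j. a (Suc j))"
    unfolding cf_convergent.simps
  proof (intro tendsto_add tendsto_const tendsto_divide)
    show "cf_convergent (\<lambda>j. a (Suc j)) \<longlonglongrightarrow> contfrac (\<lambda>j. a (Suc j))"
      by (rule cf_convergent_LIMSEQ) (rule assms)
    have "1 \<le> contfrac (\<lambda>j. a (Suc j))" by (rule contfrac_ge_1) (rule assms)
    then show "contfrac (\<lambda>j. a (Suc j)) \<noteq> 0" by linarith
  qed
  moreover have "(\<lambda>n. cf_convergent a (Suc n)) \<longlonglongrightarrow> contfrac a"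
    by (rule LIMSEQ_Suc, rule cf_convergent_LIMSEQ) (rule assms)
  ultimately show ?thesis by (rule LIMSEQ_unique[THEN sym])
qed

text \<open>Removing the integer part lets both halves of \<open>lambda_at\<close> be treated alike:
  the value is the central letter plus two tails.\<close>

definition tail :: "(nat \<Rightarrow> nat) \<Rightarrow> real" where
  "tail f = contfrac (case_nat 0 f)"

lemma tail_eq_inverse_contfrac:
  assumes "\<And>j. 1 \<le> f j"
  shows "tail f = 1 / contfrac f"
  using contfrac_rec[of "case_nat 0 f"] assms by (simp add: tail_def)

lemma contfrac_eq_tail:
  assumes "\<And>j. 1 \<le> f (Suc j)"
  shows "contfrac f = real (f 0) + tail (\<lambda>j. f (Suc j))"
  using contfrac_rec[of f, OF assms] tail_eq_inverse_contfrac[of "\<lambda>j. f (Suc j)", OF assms] by simp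

lemma tail_rec:
  assumes "\<And>j. 1 \<le> f j"
  shows "tail f = 1 / (real (f 0) + tail (\<lambda>j. f (Suc j)))"
  using tail_eq_inverse_contfrac[of f, OF assms] contfrac_eq_tail[of f, OF assms] by simp

lemma tail_bounds:
  assumes "\<And>j. 1 \<le> f j"
  shows "0 < tail f" "tail f \<le> 1"
  using contfrac_ge_1[of f, OF assms] tail_eq_inverse_contfrac[of f, OF assms] by auto

definition right_of :: "(int \<Rightarrow> nat) \<Rightarrow> int \<Rightarrow> nat \<Rightarrow> nat" where
  "right_of \<theta> c = (\<lambda>j. \<theta> (c + int j))"

text \<open>The shift by 1 against \<open>right_of\<close> makes \<open>c\<close> denote the cut
  just before letter \<open>c\<close>, so that the two halves do not overlap. At letter
  \<open>i\<close>, \<open>lambda_at\<close> uses the cuts \<open>i + 1\<close> and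
  \<open>i\<close>, which leave out the letter itself.\<close>

definition left_of :: "(int \<Rightarrow> nat) \<Rightarrow> int \<Rightarrow> nat \<Rightarrow> nat" where
  "left_of \<theta> c = (\<lambda>j. \<theta> (c - 1 - int j))"

lemma tail_right_of:
  assumes "positive_word \<theta>"
  shows "tail (right_of \<theta> c) = 1 / (real (\<theta> c) + tail (right_of \<theta> (c + 1)))"
proof -
  have "(\<lambda>j. right_of \<theta> c (Suc j)) = right_of \<theta> (c + 1)"
    by (auto simp: right_of_def add.assoc)
  then show ?thesis
    using tail_rec[of "right_of \<theta> c"] assms by (simp add: right_of_def positive_word_def)
qed

lemma tail_left_of:
  assumes "positive_word \<theta>"
  shows "tail (left_of \<theta> c) = 1 / (real (\<theta> (c - 1)) + tail (left_of \<theta> (c - 1)))"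
proof -
  have "(\<lambda>j. left_of \<theta> c (Suc j)) = left_of \<theta> (c - 1)"
    by (auto simp: left_of_def diff_diff_eq add.assoc)
  then show ?thesis
    using tail_rec[of "left_of \<theta> c"] assms by (simp add: left_of_def positive_word_def)
qed

lemma lambda_at_eq:
  assumes "positive_word \<theta>"
  shows "lambda_at \<theta> i = real (\<theta> i) + tail (right_of \<theta> (i + 1)) + tail (left_of \<theta> i)"
proof -
  have "(\<lambda>j. \<theta> (i + int (Suc j))) = right_of \<theta> (i + 1)"
    by (auto simp: right_of_def add.assoc)
  then have "contfrac (\<lambda>j. \<theta> (i + int j)) = real (\<theta> i) + tail (right_of \<theta> (i + 1))"
    using contfrac_eq_tail[of "\<lambda>j. \<theta> (i + int j)"] assms by (simp add: positive_word_def)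
  moreover have "(\<lambda>j. if j = 0 then 0 else \<theta> (i - int j)) = case_nat 0 (left_of \<theta> i)"
    by (auto simp: left_of_def fun_eq_iff diff_diff_eq split: nat.split)
  ultimately show ?thesis by (simp add: lambda_at_def tail_def)
qed

lemma tail_right_of_bounds:
  assumes "positive_word \<theta>"
  shows "0 < tail (right_of \<theta> c)" "tail (right_of \<theta> c) \<le> 1 / real (\<theta> c)"
    "1 / real (\<theta> c + 1) \<le> tail (right_of \<theta> c)"
proof -
  have *: "0 < tail (right_of \<theta> d)" "tail (right_of \<theta> d) \<le> 1" for d
    using assms by (auto intro!: tail_bounds simp: positive_word_def right_of_def)
  have "1 \<le> real (\<theta> c)" using assms by (auto simp: positive_word_def Suc_le_eq)
  then show "0 < tail (right_of \<theta> c)" "tail (right_of \<theta> c) \<le> 1 / real (\<theta> c)"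
    "1 / real (\<theta> c + 1) \<le> tail (right_of \<theta> c)"
    using *[of c] *[of "c + 1"] tail_right_of[OF assms, of c] by (auto simp: frac_le)
qed

lemma tail_left_of_bounds:
  assumes "positive_word \<theta>"
  shows "0 < tail (left_of \<theta> c)" "tail (left_of \<theta> c) \<le> 1 / real (\<theta> (c - 1))"
    "1 / real (\<theta> (c - 1) + 1) \<le> tail (left_of \<theta> c)"
proof -
  have *: "0 < tail (left_of \<theta> d)" "tail (left_of \<theta> d) \<le> 1" for d
    using assms by (auto intro!: tail_bounds simp: positive_word_def left_of_def)
  have "1 \<le> real (\<theta> (c - 1))" using assms by (auto simp: positive_word_def Suc_le_eq)
  then show "0 < tail (left_of \<theta> c)" "tail (left_of \<theta> c) \<le> 1 / real (\<theta> (c - 1))"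
    "1 / real (\<theta> (c - 1) + 1) \<le> tail (left_of \<theta> c)"
    using *[of c] *[of "c - 1"] tail_left_of[OF assms, of c] by (auto simp: frac_le)
qed

lemma lambda_at_reflect:
  assumes "positive_word \<theta>"
  shows "lambda_at (\<lambda>n. \<theta> (- n)) i = lambda_at \<theta> (- i)"
proof -
  have "right_of (\<lambda>n. \<theta> (- n)) (i + 1) = left_of \<theta> (- i)"
    "left_of (\<lambda>n. \<theta> (- n)) i = right_of \<theta> (- i + 1)"
    by (auto simp: right_of_def left_of_def fun_eq_iff intro!: arg_cong[of _ _ \<theta>])
  moreover have "positive_word (\<lambda>n. \<theta> (- n))" using assms by (auto simp: positive_word_def)
  ultimately show ?thesis using assms by (simp add: lambda_at_eq)
qed

text \<open>The crude bounds \<open>1 + 1 + 1\<close> and \<open>2 + 1/2 + 1/2\<close> suffice. Over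
  the letters 1 and 2 this leaves only the ends of blocks of 2s.\<close>

lemma lambda_at_le_3:
  assumes "positive_word \<theta>" "\<theta> i = 1 \<or> \<theta> i = 2 \<and> 2 \<le> \<theta> (i - 1) \<and> 2 \<le> \<theta> (i + 1)"
  shows "lambda_at \<theta> i \<le> 3"
proof -
  have *: "1 / real (\<theta> j) \<le> 1" for j
    using assms(1) by (auto simp: positive_word_def divide_le_eq_1 Suc_le_eq)
  have "1 / real (\<theta> j) \<le> 1 / 2" if "2 \<le> \<theta> j" for j using that by (simp add: frac_le)
  then have "tail (left_of \<theta> i) \<le> 1 / 2 \<and> tail (right_of \<theta> (i + 1)) \<le> 1 / 2"
    if "2 \<le> \<theta> (i - 1)" "2 \<le> \<theta> (i + 1)"
    using that tail_left_of_bounds(2)[OF assms(1), of i]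
      tail_right_of_bounds(2)[OF assms(1), of "i + 1"] by (meson order_trans)
  moreover have "tail (left_of \<theta> i) \<le> 1" "tail (right_of \<theta> (i + 1)) \<le> 1"
    using *[of "i - 1"] *[of "i + 1"] tail_left_of_bounds(2)[OF assms(1), of i]
      tail_right_of_bounds(2)[OF assms(1), of "i + 1"] by linarith+
  ultimately show ?thesis
    using assms(2) lambda_at_eq[OF assms(1), of i] by auto
qed

section \<open>Blocks of ones and twos\<close>

text \<open>The finite continued fraction \<open>[0; a1, ..., an + t]\<close> as a function of the
  unknown tail \<open>t\<close>: a Moebius map, monotone in a direction given by the parity of
  \<open>n\<close>.\<close>

fun cfv :: "nat list \<Rightarrow> real \<Rightarrow> real" where
  "cfv [] t = t"
| "cfv (a # as) t = 1 / (real a + cfv as t)"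

lemma cfv_append: "cfv (xs @ ys) t = cfv xs (cfv ys t)"
  by (induction xs) auto

lemma tail_right_of_cfv:
  assumes "positive_word \<theta>" "\<And>j. j < length xs \<Longrightarrow> \<theta> (c + int j) = xs ! j"
  shows "tail (right_of \<theta> c) = cfv xs (tail (right_of \<theta> (c + int (length xs))))"
  using assms(2)
proof (induction xs arbitrary: c)
  case (Cons a xs)
  have "\<theta> (c + 1 + int j) = xs ! j" if "j < length xs" for j
    using Cons.prems[of "Suc j"] that by (simp add: add.assoc)
  then have "tail (right_of \<theta> (c + 1)) = cfv xs (tail (right_of \<theta> (c + 1 + int (length xs))))"
    by (rule Cons.IH)
  moreover have "\<theta> c = a" using Cons.prems[of 0] by simp
  ultimately show ?case using tail_right_of[OF assms(1), of c] by (simp add: add.assoc)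
qed simp

lemma tail_left_of_cfv:
  assumes "positive_word \<theta>" "\<And>j. j < length xs \<Longrightarrow> \<theta> (c + int j) = xs ! j"
  shows "tail (left_of \<theta> (c + int (length xs))) = cfv (rev xs) (tail (left_of \<theta> c))"
  using assms(2)
proof (induction xs rule: rev_induct)
  case (snoc a xs)
  have "tail (left_of \<theta> (c + int (length xs))) = cfv (rev xs) (tail (left_of \<theta> c))"
    by (rule snoc.IH) (use snoc.prems in \<open>auto simp: nth_append split: if_splits\<close>)
  moreover have "\<theta> (c + int (length xs)) = a" using snoc.prems[of "length xs"] by simp
  ultimately show ?case
    using tail_left_of[OF assms(1), of "c + int (length (xs @ [a]))"] by simp
qed simp

lemma lambda_at_split:
  assumes "positive_word \<theta>" "\<And>j. j < length (u @ a # v) \<Longrightarrow> \<theta> (c + int j) = (u @ a # v) ! j"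
  shows "lambda_at \<theta> (c + int (length u)) =
    real a + cfv v (tail (right_of \<theta> (c + int (length (u @ a # v))))) + cfv (rev u) (tail (left_of \<theta> c))"
proof -
  have "\<theta> (c + int (length u) + 1 + int j) = v ! j" if "j < length v" for j
    using assms(2)[of "length u + 1 + j"] that by (simp add: nth_append algebra_simps)
  from tail_right_of_cfv[of \<theta> v "c + int (length u) + 1", OF assms(1) this]
  have "tail (right_of \<theta> (c + int (length u) + 1)) = cfv v (tail (right_of \<theta> (c + int (length (u @ a # v)))))"
    by (simp add: add_ac)
  moreover have "\<theta> (c + int (length u)) = a" using assms(2)[of "length u"] by simp
  moreover have "tail (left_of \<theta> (c + int (length u))) = cfv (rev u) (tail (left_of \<theta> c))"
    by (rule tail_left_of_cfv[OF assms(1)]) (use assms(2) in \<open>simp add: nth_append\<close>)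
  ultimately show ?thesis by (simp add: lambda_at_eq[OF assms(1)])
qed

section \<open>The maps of tails induced by blocks of 2s and by the block 11\<close>

definition twos :: "nat \<Rightarrow> real \<Rightarrow> real" where
  "twos n = cfv (replicate n 2)"

definition ones :: "real \<Rightarrow> real" where
  "ones = cfv [1, 1]"

lemma twos_0 [simp]: "twos 0 x = x"
  and twos_Suc: "twos (Suc n) x = 1 / (2 + twos n x)"
  by (simp_all add: twos_def)

lemma twos_add: "twos (m + n) x = twos m (twos n x)"
  by (simp add: twos_def replicate_add cfv_append)

lemma twos_range:
  assumes "0 \<le> x" "x \<le> 1"
  shows "0 \<le> twos n x" "twos n x \<le> 1"
proof (induction n)
  case (Suc n)
  { case 1 show ?case using Suc by (simp add: twos_Suc) }
  { case 2 show ?case using Suc by (simp add: twos_Suc divide_le_eq_1) }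
qed (use assms in auto)

lemma twos_range_pos:
  assumes "0 \<le> x" "x \<le> 1" "0 < n"
  shows "1 / 3 \<le> twos n x" "twos n x \<le> 1 / 2"
proof -
  obtain m where n: "n = Suc m" using assms(3) gr0_implies_Suc by blast
  show "1 / 3 \<le> twos n x" "twos n x \<le> 1 / 2"
    using twos_range[OF assms(1,2), of m] by (simp_all add: n twos_Suc frac_le)
qed

text \<open>The identity of the overview, in the form used from here on: a block 11 acts like a
  single 2 followed by \<open>1 - _\<close>. It turns the sum of two tails at the end of a block of
  2s into a difference of tails that both begin with 2s.\<close>

lemma ones_eq: "0 \<le> x \<Longrightarrow> ones x = 1 - 1 / (2 + x)"
  by (simp add: ones_def field_simps)

lemma ones_twos: "0 \<le> x \<Longrightarrow> x \<le> 1 \<Longrightarrow> ones (twos n x) = 1 - twos (Suc n) x"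
  by (simp add: ones_eq twos_range twos_Suc)

lemma ones_range:
  assumes "0 \<le> x" "x \<le> 1"
  shows "1 / 2 \<le> ones x" "ones x \<le> 2 / 3" "0 \<le> ones x" "ones x \<le> 1"
proof -
  have "1 / 3 \<le> 1 / (2 + x)" "1 / (2 + x) \<le> 1 / 2" using assms by (simp_all add: frac_le)
  then show "1 / 2 \<le> ones x" "ones x \<le> 2 / 3" "0 \<le> ones x" "ones x \<le> 1"
    using ones_eq[OF assms(1)] by linarith+
qed

lemma ones_mono: "0 \<le> x \<Longrightarrow> x \<le> y \<Longrightarrow> ones x \<le> ones y"
  by (simp add: ones_eq frac_le)

lemma cfv_nonneg: "0 \<le> t \<Longrightarrow> 0 \<le> cfv xs t"
  by (induction xs) auto

lemma cfv_strict_mono: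
  assumes "0 \<notin> set xs" "0 \<le> x" "x < y"
  shows "if even (length xs) then cfv xs x < cfv xs y else cfv xs y < cfv xs x"
  using assms(1)
proof (induction xs)
  case (Cons a xs)
  have *: "0 < real a + cfv xs x" "0 < real a + cfv xs y"
    using Cons.prems assms(2,3) cfv_nonneg[of x xs] cfv_nonneg[of y xs] by auto
  show ?case
    using Cons * by (auto intro!: divide_strict_left_mono split: if_splits)
qed (use assms in auto)

lemma twos_even_strict_mono: "even n \<Longrightarrow> 0 \<le> x \<Longrightarrow> x < y \<Longrightarrow> twos n x < twos n y"
  and twos_odd_strict_antimono: "odd n \<Longrightarrow> 0 \<le> x \<Longrightarrow> x < y \<Longrightarrow> twos n y < twos n x"
  using cfv_strict_mono[of "replicate n 2" x y] by (auto simp: twos_def)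

lemma twos_even_mono: "even n \<Longrightarrow> 0 \<le> x \<Longrightarrow> x \<le> y \<Longrightarrow> twos n x \<le> twos n y"
  and twos_odd_antimono: "odd n \<Longrightarrow> 0 \<le> x \<Longrightarrow> x \<le> y \<Longrightarrow> twos n y \<le> twos n x"
  using twos_even_strict_mono[of n x y] twos_odd_strict_antimono[of n x y]
  by (cases "x = y"; force)+

text \<open>After \<open>n\<close> common 2s one word continues with 1 (tail at least 1/2), the
  other with 2 (tail at most 1/2), and the odd prefix reverses the order. This is what keeps most
  block ends at value at most 3.\<close>

lemma twos_ones_le:
  assumes "odd n" "n < m" "0 \<le> x" "x \<le> 1" "0 \<le> y" "y \<le> 1"
  shows "twos n (ones x) \<le> twos m y"
proof -
  have "twos (m - n) y \<le> ones x"
    using twos_range_pos[of y "m - n"] ones_range[of x] assms by auto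
  then have "twos n (ones x) \<le> twos n (twos (m - n) y)"
    using assms twos_range[of y "m - n"] by (intro twos_odd_antimono) auto
  then show ?thesis using assms(2) by (simp flip: twos_add)
qed

text \<open>The value at the first letter of the block \<open>2\<^bsub>2k+1\<^esub>\<close> of a copy of \<open>omega k\<close> that is followed by
  a word with tail \<open>\<rho>\<close> and preceded by a word with tail \<open>l\<close>.\<close>

definition peak :: "nat \<Rightarrow> real \<Rightarrow> real \<Rightarrow> real" where
  "peak k \<rho> l = 3 + twos (2 * k) (ones (twos (2 * k + 2) (ones \<rho>))) - twos (2 * k) (1 / (2 + l))"

section \<open>Inequalities for the peak value\<close>

lemma inverse_2_plus_le: "1 / 2 \<le> (l :: real) \<Longrightarrow> 1 / (2 + l) \<le> 2 / 5"
  by (simp add: field_simps)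

lemma three_le_peak:
  assumes "0 \<le> \<rho>" "\<rho> \<le> 1" "1 / 2 \<le> l"
  shows "3 \<le> peak k \<rho> l"
proof -
  have "1 / (2 + l) \<le> ones (twos (2 * k + 2) (ones \<rho>))"
    using inverse_2_plus_le[OF assms(3)] ones_range[of "twos (2 * k + 2) (ones \<rho>)"]
      twos_range[of "ones \<rho>" "2 * k + 2"] ones_range[of \<rho>] assms by linarith
  then show ?thesis
    unfolding peak_def using assms twos_even_mono[of "2 * k" "1 / (2 + l)"] by auto
qed

lemma peak_mono:
  assumes "0 \<le> \<rho>" "\<rho> \<le> \<sigma>" "\<sigma> \<le> 1"
  shows "peak k \<rho> l \<le> peak k \<sigma> l"
  unfolding peak_def using assms
  by (intro add_mono diff_mono order_refl twos_even_mono ones_mono twos_range ones_range)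
    (auto intro!: ones_range twos_range)

lemma ones_strict_mono: "0 \<le> x \<Longrightarrow> x < y \<Longrightarrow> ones x < ones y"
  by (simp add: ones_eq frac_less2)

lemma peak_strict_mono:
  assumes "0 \<le> \<rho>" "\<rho> < \<sigma>" "\<sigma> \<le> 1"
  shows "peak k \<rho> l < peak k \<sigma> l"
  unfolding peak_def using assms
  by (intro add_strict_left_mono diff_strict_right_mono twos_even_strict_mono ones_strict_mono)
    (auto intro!: ones_range twos_range)

lemma twos_2: "0 \<le> x \<Longrightarrow> twos 2 x = (2 + x) / (5 + 2 * x)"
  by (simp add: twos_Suc numeral_2_eq_2 field_simps)

lemma twos_3_ge: "0 \<le> x \<Longrightarrow> x \<le> 1 \<Longrightarrow> 7 / 17 \<le> twos 3 x"
  by (simp add: twos_Suc numeral_3_eq_3 field_simps)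

lemma twos_2_range:
  assumes "0 \<le> x" "x \<le> 1"
  shows "2 / 5 \<le> twos 2 x" "twos 2 x \<le> 3 / 7"
  using assms by (simp_all add: twos_2 field_simps)

lemma twos_2_diff: "0 \<le> x \<Longrightarrow> 0 \<le> y \<Longrightarrow> twos 2 y - twos 2 x = (y - x) / ((5 + 2 * x) * (5 + 2 * y))"
  by (simp add: twos_2 field_simps)

text \<open>The two extra 2s are absorbed by \<open>twos 2\<close>, which maps into
  \<open>[2/5, 3/7]\<close>. Thus the two arguments of \<open>twos (2 * k)\<close> for
  \<open>Suc k\<close> lie strictly inside those for \<open>k\<close>:
  \<open>1 / (2 + l) \<le> 2/5 < 7/17\<close> below and \<open>3/7 < 1/2\<close> above. The tails
  involved are otherwise arbitrary, so periodic and non-periodic words can be compared.\<close>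

lemma peak_Suc_less:
  assumes "0 \<le> \<rho>" "\<rho> \<le> 1" "1 / 2 \<le> l" "0 \<le> \<rho>'" "\<rho>' \<le> 1" "0 \<le> l'" "l' \<le> 1"
  shows "peak (Suc k) \<rho>' l' < peak k \<rho> l"
proof -
  define s s' where "s = ones (twos (2 * k + 2) (ones \<rho>))" and "s' = ones (twos (2 * Suc k + 2) (ones \<rho>'))"
  have s: "1 / 2 \<le> s" "0 \<le> s'" "s' \<le> 1"
    unfolding s_def s'_def using assms by (intro ones_range twos_range; simp)+
  have *: "twos (2 * Suc k) x = twos (2 * k) (twos 2 x)" for x
    using twos_add[of "2 * k" 2] by simp
  have "twos 3 l' = twos 2 (1 / (2 + l'))"
    using twos_add[of 2 1 l'] by (simp add: twos_Suc)
  then have "1 / (2 + l) < twos 2 (1 / (2 + l'))"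
    using inverse_2_plus_le[OF assms(3)] twos_3_ge[of l'] assms by linarith
  then have "twos (2 * k) (1 / (2 + l)) < twos (2 * Suc k) (1 / (2 + l'))"
    unfolding * using assms by (intro twos_even_strict_mono) auto
  moreover have "twos (2 * Suc k) s' \<le> twos (2 * k) s"
    unfolding * using s twos_2_range[of s'] by (intro twos_even_mono) auto
  ultimately show ?thesis unfolding peak_def s_def s'_def by linarith
qed

lemma twos_contraction:
  assumes "0 \<le> x" "x \<le> 1" "0 \<le> y" "y \<le> 1"
  shows "\<bar>twos n x - twos n y\<bar> \<le> (1 / 4) ^ n"
proof (induction n)
  case (Suc n)
  have r: "0 \<le> twos n x" "0 \<le> twos n y" using assms by (simp_all add: twos_range)
  have "twos (Suc n) x - twos (Suc n) y = (twos n y - twos n x) / ((2 + twos n x) * (2 + twos n y))"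
    unfolding twos_Suc using r by (subst diff_frac_eq) auto
  then have "\<bar>twos (Suc n) x - twos (Suc n) y\<bar> = \<bar>twos n x - twos n y\<bar> / ((2 + twos n x) * (2 + twos n y))"
    using r by (simp add: abs_mult abs_minus_commute)
  also have "\<dots> \<le> (1 / 4) ^ n / 4"
    using Suc r mult_mono[of 2 "2 + twos n x" 2 "2 + twos n y"] by (intro frac_le) auto
  finally show ?case by simp
qed (use assms in auto)

text \<open>Iterates of the increasing concave map \<open>twos 2\<close>.\<close>

lemma twos_even_concave:
  assumes "y - x \<le> y' - x'" "0 \<le> x'" "x' \<le> y'" "x' \<le> x" "y' \<le> y"
  shows "twos (2 * k) y - twos (2 * k) x \<le> twos (2 * k) y' - twos (2 * k) x'"
  using assms
proof (induction k arbitrary: x y x' y')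
  case (Suc k)
  have *: "twos (2 * Suc k) z = twos (2 * k) (twos 2 z)" for z
    using twos_add[of "2 * k" 2] by simp
  have "twos 2 y - twos 2 x \<le> twos 2 y' - twos 2 x'"
  proof (cases "x \<le> y")
    case True
    then have "(y - x) / ((5 + 2 * x) * (5 + 2 * y)) \<le> (y' - x') / ((5 + 2 * x') * (5 + 2 * y'))"
      using Suc.prems by (intro frac_le mult_mono) auto
    then show ?thesis using Suc.prems by (simp add: twos_2_diff)
  next
    case False
    then have "twos 2 y \<le> twos 2 x" "twos 2 x' \<le> twos 2 y'"
      using Suc.prems by (auto intro!: twos_even_mono)
    then show ?thesis by linarith
  qed
  then show ?case unfolding *
    using Suc.prems by (intro Suc.IH twos_even_mono) (auto simp: twos_2)
qed simp

text \<open>The left-hand side is the value at the last letter of the block \<open>2\<^bsub>2k+1\<^esub>\<close>. Its positive part exceeds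
  that of \<open>peak\<close>, so monotonicity does not suffice here.\<close>

lemma peak_ge_mirror:
  assumes "1 \<le> k" "0 \<le> \<rho>" "\<rho> \<le> 1" "1 / 2 \<le> l" "l \<le> 1"
  shows "2 + ones (twos (2 * k + 2) (ones \<rho>)) + twos (2 * k) (ones (twos (2 * k) l)) \<le> peak k \<rho> l"
proof -
  define a b where "a = twos (2 * k) l" and "b = twos (2 * k + 2) (ones \<rho>)"
  have \<rho>: "0 \<le> ones \<rho>" "ones \<rho> \<le> 1" using assms by (simp_all add: ones_range)
  have "a = twos 2 (twos (2 * k - 2) l)" "b = twos 2 (twos (2 * k) (ones \<rho>))"
    using assms(1) twos_add[of 2 "2 * k - 2" l] twos_add[of 2 "2 * k" "ones \<rho>"]
    by (simp_all only: a_def b_def add.commute[of "2 * k"] le_add_diff_inverse mult_le_mono2[of 1 k 2, simplified])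
  then have ab: "a \<le> 3 / 7" "2 / 5 \<le> b" "0 \<le> a" "b \<le> 3 / 7" "2 / 5 \<le> a"
    using assms \<rho> twos_2_range twos_range by auto
  have t: "7 / 17 \<le> twos 3 (ones \<rho>)" "1 / (2 + l) \<le> 2 / 5"
    using \<rho> twos_3_ge inverse_2_plus_le assms by auto
  \<comment> \<open>After rewriting \<open>ones b\<close> by \<open>ones_twos\<close>, the claim
    compares two differences of values of \<open>twos (2 * k)\<close>. On the left the arguments
    differ by at most 1/140, on the right by at least \<open>7/17 - 2/5 = 1/85\<close>, and the left
    pair lies above the right pair, so concavity applies.\<close>
  have "ones a - ones b = (a - b) / ((2 + a) * (2 + b))"
    using ab by (simp add: ones_eq) (simp add: divide_simps)
  also have "\<dots> \<le> (3 / 7 - 2 / 5) / (2 * 2)"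
    using ab by (intro frac_le mult_mono) auto
  also have "\<dots> \<le> 7 / 17 - 2 / 5" by simp
  also have "\<dots> \<le> twos 3 (ones \<rho>) - 1 / (2 + l)" using t by simp
  finally have "twos (2 * k) (ones a) - twos (2 * k) (ones b)
      \<le> twos (2 * k) (twos 3 (ones \<rho>)) - twos (2 * k) (1 / (2 + l))"
    using t assms ab ones_range[of a] ones_range[of b] twos_range_pos[OF \<rho>, of 3]
    by (intro twos_even_concave) auto
  moreover have "ones b = 1 - twos (2 * k) (twos 3 (ones \<rho>))"
    unfolding b_def using \<rho> by (simp add: ones_twos eval_nat_numeral flip: twos_add)
  ultimately show ?thesis unfolding peak_def a_def b_def by simp
qed

text \<open>In \<open>peak\<close> the map \<open>twos (2 * k)\<close> is taken at an argument at
  least 1/2 and at \<open>1 / (2 + l)\<close>; being increasing, it makes \<open>peak\<close>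
  dominate every difference with arguments between these. Needed for the last block end of a copy
  and for the first of the trailing 2s of \<open>gamma1 k\<close>.\<close>

lemma le_peak:
  assumes "0 \<le> \<rho>" "\<rho> \<le> 1" "0 \<le> l" "x \<le> 1 / 2" "0 \<le> x" "1 / (2 + l) \<le> y"
  shows "3 + twos (2 * k) x - twos (2 * k) y \<le> peak k \<rho> l"
proof -
  have "1 / 2 \<le> ones (twos (2 * k + 2) (ones \<rho>))"
    using assms by (intro ones_range twos_range) auto
  then show ?thesis
    unfolding peak_def using assms by (intro add_mono diff_mono order_refl twos_even_mono) auto
qed

section \<open>A copy of \<open>omega k\<close> inside a bi-infinite word\<close>

lemma length_omega [simp]: "length (omega k) = 6 * k + 9"
  by (simp add: omega_def)

lemma omega_nth:
  "j < 6 * k + 9 \<Longrightarrow> omega k ! j =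
    (if j < 2 * k then 2 else if j < 2 * k + 2 then 1 else if j < 4 * k + 3 then 2
     else if j < 4 * k + 5 then 1 else if j < 6 * k + 7 then 2 else 1)"
  by (auto simp: omega_def nth_append simp del: replicate.simps)

lemma cfv_twos: "cfv (replicate n 2) t = twos n t"
  and cfv_ones: "cfv [1, 1] t = ones t"
  by (simp_all add: twos_def ones_def)

lemmas cfv_blocks = cfv_append cfv_twos cfv_ones cfv.simps(1) rev_append rev_replicate rev.simps(1)

lemma rev_ones: "rev [1, 1] = [1, 1 :: nat]"
  by simp

lemma replicate_Cons_split: "replicate (m + n + 1) a = replicate m a @ a # replicate n a"
  by (simp flip: replicate_add replicate_Suc add: replicate_app_Cons_same)

lemma omega_eq:
  "omega k = replicate (2 * k) 2 @ [1, 1] @ replicate (2 * k + 1) 2 @ [1, 1] @ replicate (2 * k + 2) 2 @ [1, 1]"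
  by (simp add: omega_def numeral_2_eq_2)

lemma cfv_omega:
  "cfv (omega k) t = twos (2 * k) (ones (twos (2 * k + 1) (ones (twos (2 * k + 2) (ones t)))))"
  by (simp only: omega_eq cfv_append cfv_twos cfv_ones)

lemma cfv_rev_omega:
  "cfv (rev (omega k)) t = ones (twos (2 * k + 2) (ones (twos (2 * k + 1) (ones (twos (2 * k) t)))))"
  by (simp only: omega_eq cfv_blocks rev_ones append_assoc)

text \<open>Covers \<open>omega_bar\<close> and \<open>gamma1\<close> together. The fixed-point
  equation for \<open>l\<close> holds because \<open>omega k\<close> repeats for ever to the left.
  The form of \<rho> reflects that at least \<open>2 * k\<close> letters 2 follow the copy, and
  \<open>r \<le> l\<close> is what the end of its last block of 2s requires.\<close>

locale omega_copy =
  fixes \<theta> :: "int \<Rightarrow> nat" and k :: nat and c :: int and l \<rho> r :: real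
  assumes pos: "positive_word \<theta>" and k: "1 \<le> k"
    and copy: "\<And>j. j < 6 * k + 9 \<Longrightarrow> \<theta> (c + int j) = omega k ! j"
    and l: "l = tail (left_of \<theta> c)" "l = cfv (rev (omega k)) l"
    and \<rho>: "\<rho> = tail (right_of \<theta> (c + int (6 * k + 9)))"
    and r: "\<rho> = twos (2 * k) r" "0 \<le> r" "r \<le> l"
begin

lemma l_range: "1 / 2 \<le> l" "0 \<le> l" "l \<le> 1"
proof -
  have "0 \<le> l" "l \<le> 1"
    unfolding l(1) using pos tail_bounds[of "left_of \<theta> c"] by (auto simp: left_of_def positive_word_def less_imp_le)
  moreover from this have "1 / 2 \<le> ones (twos (2 * k + 2) (ones (twos (2 * k + 1) (ones (twos (2 * k) l)))))"
    by (intro ones_range twos_range)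
  ultimately show "1 / 2 \<le> l" "0 \<le> l" "l \<le> 1"
    using l(2) unfolding cfv_rev_omega by linarith+
qed

lemma \<rho>_range: "0 \<le> \<rho>" "\<rho> \<le> 1"
  using r l_range by (auto intro: twos_range)

lemma split:
  assumes "omega k = u @ 2 # v" "length u = j"
  shows "lambda_at \<theta> (c + int j) = 2 + cfv v \<rho> + cfv (rev u) l"
proof -
  have len: "length (u @ 2 # v) = 6 * k + 9" unfolding assms(1)[symmetric] by simp
  have "lambda_at \<theta> (c + int (length u)) = real 2 + cfv v (tail (right_of \<theta> (c + int (length (u @ 2 # v)))))
      + cfv (rev u) (tail (left_of \<theta> c))"
    by (rule lambda_at_split[OF pos], unfold assms(1)[symmetric]) (simp add: copy)
  then show ?thesis unfolding len assms(2) \<rho>[symmetric] l(1)[symmetric] by simp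
qed

lemma peak_at: "lambda_at \<theta> (c + int (2 * k + 2)) = peak k \<rho> l"
proof -
  have e: "replicate (2 * k + 1) 2 = 2 # replicate (2 * k) 2" by simp
  have "omega k = (replicate (2 * k) 2 @ [1, 1]) @ 2 #
      (replicate (2 * k) 2 @ [1, 1] @ replicate (2 * k + 2) 2 @ [1, 1])"
    by (simp only: omega_eq e append.simps append_assoc)
  then have "lambda_at \<theta> (c + int (2 * k + 2)) =
      2 + twos (2 * k) (ones (twos (2 * k + 2) (ones \<rho>))) + ones (twos (2 * k) l)"
    by (rule split[THEN trans]) (simp_all only: cfv_blocks rev_ones append_assoc, simp_all)
  moreover have "ones (twos (2 * k) l) = 1 - twos (2 * k) (1 / (2 + l))"
    using twos_add[of "2 * k" 1 l] l_range by (simp add: ones_twos twos_Suc)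
  ultimately show ?thesis by (simp add: peak_def)
qed

text \<open>Only the six ends of the three blocks of 2s need work. For three of them, an even block
  without its end letter is an odd block, and \<open>twos_ones_le\<close> against a longer block
  gives at most 3. There remain the peak itself, its mirror image at the other end of the odd block,
  and the last letter of the third block.\<close>

lemma le_peak_at:
  assumes "j < 6 * k + 9"
  shows "lambda_at \<theta> (c + int j) \<le> peak k \<rho> l"
proof -
  note rng = l_range \<rho>_range
  have peak3: "3 \<le> peak k \<rho> l" by (rule three_le_peak) (use rng in auto)
  define x where "x = ones (twos (2 * k + 1) (ones (twos (2 * k) l)))"
  define y where "y = ones (twos (2 * k + 2) (ones \<rho>))"
  have x: "0 \<le> x" "x \<le> 1" and y: "0 \<le> y" "y \<le> 1"
    unfolding x_def y_def using rng by (auto intro!: ones_range twos_range)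
  have lx: "l = ones (twos (2 * k + 2) x)" using l(2) by (simp add: cfv_rev_omega x_def)
  consider "omega k ! j = 1"
    | "0 < j" "j < 6 * k + 8" "omega k ! j = 2" "omega k ! (j - 1) = 2" "omega k ! (j + 1) = 2"
    | "j = 0" | "j = 2 * k - 1" | "j = 2 * k + 2" | "j = 4 * k + 2" | "j = 4 * k + 5" | "j = 6 * k + 6"
  proof -
    consider "j \<in> {0, 2 * k - 1, 2 * k + 2, 4 * k + 2, 4 * k + 5, 6 * k + 6}"
      | "0 < j" "j + 1 < 2 * k" | "2 * k \<le> j" "j < 2 * k + 2" | "2 * k + 2 < j" "j < 4 * k + 2"
      | "4 * k + 3 \<le> j" "j < 4 * k + 5" | "4 * k + 5 < j" "j < 6 * k + 6" | "6 * k + 7 \<le> j"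
      by force
    then show thesis
      using assms by cases (auto simp: omega_nth intro: that)
  qed
  then show ?thesis
  proof cases
    case 1
    then have "lambda_at \<theta> (c + int j) \<le> 3"
      using copy[OF assms] by (intro lambda_at_le_3 pos) auto
    with peak3 show ?thesis by linarith
  next
    case 2
    then have "lambda_at \<theta> (c + int j) \<le> 3"
      using copy[OF assms] copy[of "j - 1"] copy[of "j + 1"]
      by (intro lambda_at_le_3 pos) (auto simp: of_nat_diff algebra_simps)
    with peak3 show ?thesis by linarith
  next
    case 3
    have e: "replicate (2 * k) 2 = 2 # replicate (2 * k - 1) 2"
      using replicate_Cons_split[of 0 "2 * k - 1"] k by simp
    have "omega k = [] @ 2 # replicate (2 * k - 1) 2 @ [1, 1] @ replicate (2 * k + 1) 2 @ [1, 1] @ replicate (2 * k + 2) 2 @ [1, 1]"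
      by (simp only: omega_eq e append.simps append_assoc)
    then have "lambda_at \<theta> (c + int j) = 2 + twos (2 * k - 1) (ones (twos (2 * k + 1) y)) + l"
      by (rule split[THEN trans]) (use 3 in \<open>simp_all only: cfv_blocks rev_ones append_assoc y_def x_def, simp_all\<close>)
    moreover have "twos (2 * k - 1) (ones (twos (2 * k + 1) y)) \<le> twos (2 * k + 3) x"
      by (rule twos_ones_le) (use k x y rng in \<open>auto intro!: twos_range ones_range\<close>)
    moreover have "l = 1 - twos (2 * k + 3) x"
      using lx ones_twos[OF x, of "2 * k + 2"] by (simp add: numeral_3_eq_3)
    ultimately show ?thesis using peak3 by linarith
  next
    case 4
    have e: "replicate (2 * k) 2 = replicate (2 * k - 1) 2 @ 2 # []"
      using replicate_Cons_split[of "2 * k - 1" 0] k by simp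
    have "omega k = replicate (2 * k - 1) 2 @ 2 # [1, 1] @ replicate (2 * k + 1) 2 @ [1, 1] @ replicate (2 * k + 2) 2 @ [1, 1]"
      by (simp only: omega_eq e append.simps append_assoc)
    then have "lambda_at \<theta> (c + int j) = 2 + ones (twos (2 * k + 1) y) + twos (2 * k - 1) l"
      by (rule split[THEN trans]) (use 4 in \<open>simp_all only: cfv_blocks rev_ones append_assoc y_def x_def, simp_all\<close>)
    moreover have "twos (2 * k - 1) l \<le> twos (2 * k + 2) y"
      by (subst lx, rule twos_ones_le) (use k x y rng in \<open>auto intro!: twos_range ones_range\<close>)
    moreover have "ones (twos (2 * k + 1) y) = 1 - twos (2 * k + 2) y"
      using ones_twos[OF y, of "2 * k + 1"] by simp
    ultimately show ?thesis using peak3 by linarith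
  next
    case 5
    then show ?thesis using peak_at by simp
  next
    case 6
    have e: "replicate (2 * k + 1) 2 = replicate (2 * k) 2 @ 2 # []"
      using replicate_Cons_split[of "2 * k" 0] by simp
    have "omega k = (replicate (2 * k) 2 @ [1, 1] @ replicate (2 * k) 2) @ 2 # [1, 1] @ replicate (2 * k + 2) 2 @ [1, 1]"
      by (simp only: omega_eq e append.simps append_assoc)
    then have "lambda_at \<theta> (c + int j) = 2 + y + twos (2 * k) (ones (twos (2 * k) l))"
      by (rule split[THEN trans]) (use 6 in \<open>simp_all only: cfv_blocks rev_ones append_assoc y_def x_def, simp_all\<close>)
    also have "\<dots> \<le> peak k \<rho> l" unfolding y_def by (rule peak_ge_mirror[OF k]) (use rng in auto)
    finally show ?thesis .
  next
    case 7
    have e: "replicate (2 * k + 2) 2 = 2 # replicate (2 * k + 1) 2"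
      by simp
    have "omega k = (replicate (2 * k) 2 @ [1, 1] @ replicate (2 * k + 1) 2 @ [1, 1]) @ 2 # replicate (2 * k + 1) 2 @ [1, 1]"
      by (simp only: omega_eq e append.simps append_assoc)
    then have "lambda_at \<theta> (c + int j) = 2 + twos (2 * k + 1) (ones \<rho>) + x"
      by (rule split[THEN trans]) (use 7 in \<open>simp_all only: cfv_blocks rev_ones append_assoc y_def x_def, simp_all\<close>)
    moreover have "twos (2 * k + 1) (ones \<rho>) \<le> twos (2 * k + 2) (ones (twos (2 * k) l))"
      by (rule twos_ones_le) (use k x y rng in \<open>auto intro!: twos_range ones_range\<close>)
    moreover have "x = 1 - twos (2 * k + 2) (ones (twos (2 * k) l))"
      unfolding x_def using ones_twos[of "ones (twos (2 * k) l)" "2 * k + 1"] rng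
      by (simp add: ones_range twos_range)
    ultimately show ?thesis using peak3 by linarith
  next
    case 8
    have e: "replicate (2 * k + 2) 2 = replicate (2 * k + 1) 2 @ 2 # []"
      using replicate_Cons_split[of "2 * k + 1" 0] by simp
    have "omega k = (replicate (2 * k) 2 @ [1, 1] @ replicate (2 * k + 1) 2 @ [1, 1] @ replicate (2 * k + 1) 2) @ 2 # [1, 1]"
      by (simp only: omega_eq e append.simps append_assoc)
    then have "lambda_at \<theta> (c + int j) = 2 + ones \<rho> + twos (2 * k + 1) x"
      by (rule split[THEN trans]) (use 8 in \<open>simp_all only: cfv_blocks rev_ones append_assoc y_def x_def, simp_all\<close>)
    also have "ones \<rho> = 1 - twos (2 * k) (1 / (2 + r))"
      using twos_add[of "2 * k" 1 r] r l_range by (simp add: ones_twos twos_Suc)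
    also have "twos (2 * k + 1) x = twos (2 * k) (1 / (2 + x))"
      using twos_add[of "2 * k" 1 x] by (simp add: twos_Suc)
    finally have "lambda_at \<theta> (c + int j) = 3 + twos (2 * k) (1 / (2 + x)) - twos (2 * k) (1 / (2 + r))"
      by simp
    \<comment> \<open>The block after the copy may be too short for \<open>twos_ones_le\<close>.
      Here \<open>r \<le> l\<close> enters: it places \<open>1 / (2 + r)\<close> above
      \<open>1 / (2 + l)\<close>.\<close>
    also have "\<dots> \<le> peak k \<rho> l"
      using rng x r by (intro le_peak) (auto simp: field_simps)
    finally show ?thesis .
  qed
qed

end

section \<open>The Markov values of the words\<close>

definition omega_bar :: "nat \<Rightarrow> int \<Rightarrow> nat" where
  "omega_bar k n = omega k ! nat (n mod int (6 * k + 9))"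

definition left_tail :: "nat \<Rightarrow> real" where
  "left_tail k = tail (left_of (omega_bar k) 0)"

text \<open>The number \<open>sqrt 2 - 1\<close>.\<close>

definition silver :: real where
  "silver = tail (\<lambda>_. 2)"

lemma silver_eq: "silver = 1 / (2 + silver)" and silver_range: "0 < silver" "silver < 1 / 2"
proof -
  show eq: "silver = 1 / (2 + silver)" unfolding silver_def by (subst tail_rec) auto
  show *: "0 < silver" unfolding silver_def by (intro tail_bounds) auto
  then have "1 / (2 + silver) < 1 / 2" by (intro divide_strict_left_mono) auto
  with eq show "silver < 1 / 2" by linarith
qed

lemma twos_silver: "twos n silver = silver"
  by (induction n) (auto simp: twos_Suc silver_eq[symmetric])

lemma one_le_omega_nth: "j < 6 * k + 9 \<Longrightarrow> 1 \<le> omega k ! j"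
  by (simp add: omega_nth)

lemma positive_omega_bar: "positive_word (omega_bar k)"
  unfolding positive_word_def omega_bar_def by (intro allI one_le_omega_nth) (simp add: nat_less_iff)

lemma periodic_omega_bar: "periodic_word (omega_bar k)"
  unfolding periodic_word_def by (rule exI[of _ "int (6 * k + 9)"]) (simp add: omega_bar_def)

lemma omega_bar_copy: "j < 6 * k + 9 \<Longrightarrow> omega_bar k (int (6 * k + 9) * q + int j) = omega k ! j"
  by (simp add: omega_bar_def del: of_nat_add of_nat_mult)

lemma omega_bar_shift: "omega_bar k (int (6 * k + 9) * q + n) = omega_bar k n"
  by (simp add: omega_bar_def del: of_nat_add of_nat_mult)

lemma left_of_omega_bar: "left_of (omega_bar k) (int (6 * k + 9) * q) = left_of (omega_bar k) 0"
  unfolding left_of_def using omega_bar_shift[of k q]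
  by (metis (no_types, opaque_lifting) add.commute add_diff_eq diff_0 uminus_add_conv_diff)

lemma right_of_omega_bar: "right_of (omega_bar k) (int (6 * k + 9) * q) = right_of (omega_bar k) 0"
  unfolding right_of_def using omega_bar_shift[of k q] by simp

lemma left_tail_eq: "left_tail k = cfv (rev (omega k)) (left_tail k)"
  using tail_left_of_cfv[OF positive_omega_bar[of k], where xs = "omega k" and c = 0] omega_bar_copy[of _ k 0]
    left_of_omega_bar[of k 1] by (simp add: left_tail_def)

lemma left_tail_range: "1 / 2 \<le> left_tail k" "left_tail k \<le> 1" "0 \<le> left_tail k"
proof -
  have *: "0 \<le> left_tail k" "left_tail k \<le> 1"
    unfolding left_tail_def using tail_bounds[of "left_of (omega_bar k) 0"] positive_omega_bar[of k]
    by (auto simp: left_of_def positive_word_def less_imp_le)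
  moreover from * have "1 / 2 \<le> ones (twos (2 * k + 2) (ones (twos (2 * k + 1) (ones (twos (2 * k) (left_tail k))))))"
    by (intro ones_range twos_range)
  ultimately show "1 / 2 \<le> left_tail k" "left_tail k \<le> 1" "0 \<le> left_tail k"
    using left_tail_eq[of k] unfolding cfv_rev_omega by linarith+
qed

text \<open>Provides the bound \<open>r \<le> l\<close> of \<open>omega_copy\<close> when another
  copy follows. After the block 11, the odd block of \<open>2 * k + 1\<close> letters read to the
  right meets the longer one of \<open>2 * k + 2\<close> letters read to the left.\<close>

lemma cfv_omega_bounds:
  assumes "0 \<le> t" "t \<le> 1"
  obtains r where "cfv (omega k) t = twos (2 * k) r" "1 / 2 \<le> r" "r \<le> left_tail k"
proof
  let ?r = "ones (twos (2 * k + 1) (ones (twos (2 * k + 2) (ones t))))"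
  show "cfv (omega k) t = twos (2 * k) ?r" by (rule cfv_omega)
  show "1 / 2 \<le> ?r" using assms by (intro ones_range twos_range)
  have "?r \<le> ones (twos (2 * k + 2) (ones (twos (2 * k + 1) (ones (twos (2 * k) (left_tail k))))))"
    using assms left_tail_range by (intro ones_mono twos_ones_le twos_range ones_range) auto
  then show "?r \<le> left_tail k" using left_tail_eq[of k] unfolding cfv_rev_omega by linarith
qed

lemma cfv_omega_range: "0 \<le> t \<Longrightarrow> t \<le> 1 \<Longrightarrow> 0 \<le> cfv (omega k) t \<and> cfv (omega k) t \<le> 1"
  unfolding cfv_omega by (intro conjI twos_range ones_range)

text \<open>\<open>twos\<close> fixes \<open>silver\<close>; after \<open>2 * k\<close> common 2s,
  \<open>omega k\<close> continues with a 1, whose tail is at least 1/2.\<close>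

lemma silver_less_cfv_omega:
  assumes "0 \<le> t" "t \<le> 1"
  shows "silver < cfv (omega k) t"
proof -
  obtain r where r: "cfv (omega k) t = twos (2 * k) r" "1 / 2 \<le> r"
    using assms by (rule cfv_omega_bounds)
  have "twos (2 * k) silver < twos (2 * k) r"
    using r silver_range by (intro twos_even_strict_mono) auto
  then show ?thesis using r twos_silver by simp
qed

lemma cfv_omega_strict_antimono: "0 \<le> x \<Longrightarrow> x < y \<Longrightarrow> cfv (omega k) y < cfv (omega k) x"
  using cfv_strict_mono[of "omega k" x y] by (auto simp: omega_def)

lemma cfv_omega_le: "silver \<le> t \<Longrightarrow> cfv (omega k) t \<le> cfv (omega k) silver"
  using cfv_omega_strict_antimono[of silver t k] silver_range by (cases "t = silver") auto

definition right_tail :: "nat \<Rightarrow> real" where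
  "right_tail k = tail (right_of (omega_bar k) 0)"

lemma right_tail_range: "0 \<le> right_tail k" "right_tail k \<le> 1"
  unfolding right_tail_def using tail_bounds[of "right_of (omega_bar k) 0"] positive_omega_bar[of k]
  by (auto simp: right_of_def positive_word_def less_imp_le)

lemma right_tail_eq: "right_tail k = cfv (omega k) (right_tail k)"
  using tail_right_of_cfv[OF positive_omega_bar[of k], where xs = "omega k" and c = 0] omega_bar_copy[of _ k 0]
    right_of_omega_bar[of k 1] by (simp add: right_tail_def)

lemma right_tail_less: "right_tail k < cfv (omega k) silver"
  using cfv_omega_strict_antimono[of silver "right_tail k" k] silver_less_cfv_omega[of "right_tail k" k]
    right_tail_range[of k] right_tail_eq[of k] silver_range by simp

lemma omega_copy_omega_bar:
  assumes "1 \<le> k"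
  obtains r where "\<And>q. omega_copy (omega_bar k) k (int (6 * k + 9) * q) (left_tail k) (right_tail k) r"
proof -
  obtain r where r: "right_tail k = twos (2 * k) r" "1 / 2 \<le> r" "r \<le> left_tail k"
    using cfv_omega_bounds[OF right_tail_range[of k], of k] right_tail_eq[of k] by metis
  have "omega_copy (omega_bar k) k (int (6 * k + 9) * q) (left_tail k) (right_tail k) r" for q
  proof
    show "right_tail k = tail (right_of (omega_bar k) (int (6 * k + 9) * q + int (6 * k + 9)))"
      using right_of_omega_bar[of k "q + 1"] by (simp add: right_tail_def distrib_left)
  qed (use assms r positive_omega_bar omega_bar_copy left_of_omega_bar left_tail_eq in
      \<open>auto simp: left_tail_def simp del: of_nat_add of_nat_mult\<close>)
  then show thesis by (rule that)
qed

lemma markov_value_eqI: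
  assumes "\<And>i. lambda_at \<theta> i \<le> x" "lambda_at \<theta> i0 = x"
  shows "markov_value \<theta> = ereal x"
  unfolding markov_value_def
  by (rule antisym) (use assms in \<open>auto intro!: SUP_least SUP_upper2[of i0]\<close>)

lemma markov_value_omega_bar:
  assumes "1 \<le> k"
  shows "markov_value (omega_bar k) = ereal (peak k (right_tail k) (left_tail k))"
proof -
  obtain r where copy: "\<And>q. omega_copy (omega_bar k) k (int (6 * k + 9) * q) (left_tail k) (right_tail k) r"
    using omega_copy_omega_bar[OF assms] by blast
  show ?thesis
  proof (rule markov_value_eqI)
    fix i :: int
    let ?P = "int (6 * k + 9)"
    have "nat (i mod ?P) < 6 * k + 9" by (simp add: nat_less_iff)
    from omega_copy.le_peak_at[OF copy this, of "i div ?P"]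
    show "lambda_at (omega_bar k) i \<le> peak k (right_tail k) (left_tail k)" by simp
  next
    show "lambda_at (omega_bar k) (int (6 * k + 9) * 0 + int (2 * k + 2)) = peak k (right_tail k) (left_tail k)"
      by (rule omega_copy.peak_at[OF copy])
  qed
qed

section \<open>The Markov value of \<open>gamma1 k\<close>\<close>

lemma gamma1_eq: "gamma1 k n = (if n < 2 * int (6 * k + 9) then omega_bar k n else 2)"
proof -
  consider "n < 0" | "0 \<le> n" "n < int (6 * k + 9)" | "int (6 * k + 9) \<le> n" "n < 2 * int (6 * k + 9)"
    | "2 * int (6 * k + 9) \<le> n" by linarith
  then show ?thesis
  proof cases
    case 3
    then have "n mod int (6 * k + 9) = n - int (6 * k + 9)"
      by (metis minus_mod_self2 mod_pos_pos_trivial diff_ge_0_iff_ge diff_less_eq mult_2)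
    moreover have "nat (6 * int k + 9) = 6 * k + 9" by linarith
    ultimately show ?thesis using 3
      by (simp add: gamma1_def biinfinite_word_def omega_bar_def nth_append nat_diff_distrib nat_less_iff)
  qed (auto simp: gamma1_def biinfinite_word_def omega_bar_def nth_append nat_less_iff)
qed

lemma positive_gamma1: "positive_word (gamma1 k)"
  using positive_omega_bar[of k] by (simp add: positive_word_def gamma1_eq)

lemma left_of_gamma1:
  assumes "q \<le> 2"
  shows "left_of (gamma1 k) (int (6 * k + 9) * q) = left_of (omega_bar k) 0"
proof -
  have "int (6 * k + 9) * q \<le> int (6 * k + 9) * 2" using assms by (intro mult_left_mono) auto
  then have "left_of (gamma1 k) (int (6 * k + 9) * q) = left_of (omega_bar k) (int (6 * k + 9) * q)"
    by (auto simp: left_of_def gamma1_eq fun_eq_iff)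
  then show ?thesis by (simp only: left_of_omega_bar)
qed

lemma gamma1_copy:
  assumes "q \<le> 1" "j < 6 * k + 9"
  shows "gamma1 k (int (6 * k + 9) * q + int j) = omega k ! j"
proof -
  define P where "P = int (6 * k + 9)"
  have "P * q \<le> P * 1" using assms by (intro mult_left_mono) (auto simp: P_def)
  moreover have "int j < P" using assms(2) by (simp add: P_def)
  ultimately have "int (6 * k + 9) * q + int j < 2 * int (6 * k + 9)" unfolding P_def[symmetric] by linarith
  then show ?thesis using omega_bar_copy[OF assms(2), of q] by (simp only: gamma1_eq if_True)
qed

lemma right_of_gamma1: "2 * int (6 * k + 9) \<le> c \<Longrightarrow> tail (right_of (gamma1 k) c) = silver"
  by (simp add: right_of_def gamma1_eq silver_def)

lemma right_of_gamma1_rec: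
  assumes "q \<le> 1"
  shows "tail (right_of (gamma1 k) (int (6 * k + 9) * q)) =
    cfv (omega k) (tail (right_of (gamma1 k) (int (6 * k + 9) * (q + 1))))"
proof -
  have "int (6 * k + 9) * q + int (length (omega k)) = int (6 * k + 9) * (q + 1)"
    by (simp add: distrib_left)
  then show ?thesis
    using tail_right_of_cfv[OF positive_gamma1[of k], where xs = "omega k" and c = "int (6 * k + 9) * q"]
      gamma1_copy[OF assms] by (simp only: length_omega)
qed

lemma right_of_gamma1_bounds:
  assumes "q \<le> 2"
  shows "\<exists>r. tail (right_of (gamma1 k) (int (6 * k + 9) * q)) = twos (2 * k) r \<and> 0 \<le> r \<and> r \<le> left_tail k"
    "silver \<le> tail (right_of (gamma1 k) (int (6 * k + 9) * q))"
    "tail (right_of (gamma1 k) (int (6 * k + 9) * q)) \<le> cfv (omega k) silver"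
proof -
  let ?R = "\<lambda>q. tail (right_of (gamma1 k) (int (6 * k + 9) * q))"
  have R2: "?R 2 = silver" by (rule right_of_gamma1) simp
  have rng: "0 \<le> ?R q" "?R q \<le> 1" for q
    using tail_bounds[of "right_of (gamma1 k) (int (6 * k + 9) * q)"] positive_gamma1[of k]
    by (auto simp: right_of_def positive_word_def less_imp_le)
  have low: "silver \<le> ?R q" if "q \<le> 2" for q
    using R2 right_of_gamma1_rec[of q k] silver_less_cfv_omega[OF rng, of k "q + 1"] that
    by (cases "q = 2") auto
  have silver1: "0 \<le> silver" "silver \<le> 1" using silver_range by auto
  show "\<exists>r. ?R q = twos (2 * k) r \<and> 0 \<le> r \<and> r \<le> left_tail k"
  proof (cases "q = 2")
    case True
    then show ?thesis using R2 twos_silver[of "2 * k"] silver_range left_tail_range(1)[of k]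
      by (intro exI[of _ silver]) auto
  next
    case False
    then have "?R q = cfv (omega k) (?R (q + 1))" using assms by (intro right_of_gamma1_rec) auto
    moreover obtain r where "cfv (omega k) (?R (q + 1)) = twos (2 * k) r" "1 / 2 \<le> r" "r \<le> left_tail k"
      using cfv_omega_bounds[OF rng(1)[of "q + 1"] rng(2)[of "q + 1"]] by blast
    ultimately show ?thesis by (intro exI[of _ r]) simp
  qed
  show "silver \<le> ?R q" using low assms .
  show "?R q \<le> cfv (omega k) silver"
  proof (cases "q = 2")
    case True
    then show ?thesis using R2 silver_less_cfv_omega[OF silver1, of k] by simp
  next
    case False
    then show ?thesis
      using right_of_gamma1_rec[of q k] cfv_omega_le[OF low, of "q + 1" k] assms by simp
  qed
qed

lemma omega_copy_gamma1:
  assumes "1 \<le> k" "q \<le> 1"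
  obtains r where "omega_copy (gamma1 k) k (int (6 * k + 9) * q) (left_tail k)
    (tail (right_of (gamma1 k) (int (6 * k + 9) * (q + 1)))) r"
proof -
  obtain r where r: "tail (right_of (gamma1 k) (int (6 * k + 9) * (q + 1))) = twos (2 * k) r" "0 \<le> r" "r \<le> left_tail k"
    using right_of_gamma1_bounds(1)[of "q + 1" k] assms(2) by auto
  show thesis
  proof (rule that, unfold_locales)
    show "left_tail k = tail (left_of (gamma1 k) (int (6 * k + 9) * q))"
      using left_of_gamma1[of q k] assms(2) by (simp add: left_tail_def)
    show "left_tail k = cfv (rev (omega k)) (left_tail k)" by (rule left_tail_eq)
    show "tail (right_of (gamma1 k) (int (6 * k + 9) * (q + 1)))
        = tail (right_of (gamma1 k) (int (6 * k + 9) * q + int (6 * k + 9)))"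
      by (simp add: distrib_left)
  qed (use assms r positive_gamma1 gamma1_copy in \<open>auto simp del: of_nat_add of_nat_mult\<close>)
qed

lemma lambda_at_gamma1_peak:
  assumes "1 \<le> k"
  shows "lambda_at (gamma1 k) (int (2 * k + 2)) = peak k (cfv (omega k) silver) (left_tail k)"
proof -
  let ?P = "int (6 * k + 9)"
  obtain r where copy: "omega_copy (gamma1 k) k (?P * 0) (left_tail k) (tail (right_of (gamma1 k) (?P * (0 + 1)))) r"
    using omega_copy_gamma1[OF assms, of 0] by auto
  have "tail (right_of (gamma1 k) (?P * 1)) = cfv (omega k) silver"
    using right_of_gamma1_rec[of 1 k] right_of_gamma1[of k "?P * 2"] by simp
  then show ?thesis using omega_copy.peak_at[OF copy] by simp
qed

lemma markov_value_gamma1: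
  assumes "1 \<le> k"
  shows "markov_value (gamma1 k) = ereal (peak k (cfv (omega k) silver) (left_tail k))"
proof (rule markov_value_eqI)
  let ?P = "int (6 * k + 9)" and ?l = "left_tail k"
  let ?M = "peak k (cfv (omega k) silver) ?l"
  note l = left_tail_range[of k]
  have silver1: "0 \<le> silver" "silver \<le> 1" using silver_range by auto
  note \<rho> = cfv_omega_range[OF silver1, of k]
  have M3: "3 \<le> ?M" using \<rho> l by (intro three_le_peak) auto
  fix i :: int
  consider "i < 2 * ?P" | "i = 2 * ?P" | "2 * ?P < i" by linarith
  then show "lambda_at (gamma1 k) i \<le> ?M"
  proof cases
    case 1
    have q: "i div ?P \<le> 1"
    proof (rule ccontr)
      assume "\<not> i div ?P \<le> 1"
      then have "?P * 2 \<le> ?P * (i div ?P)" by (intro mult_left_mono) auto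
      then show False using 1 mult_div_mod_eq[of ?P i] pos_mod_sign[of ?P i] by linarith
    qed
    obtain r where copy: "omega_copy (gamma1 k) k (?P * (i div ?P)) ?l
        (tail (right_of (gamma1 k) (?P * (i div ?P + 1)))) r"
      using omega_copy_gamma1[OF assms q] by blast
    have "nat (i mod ?P) < 6 * k + 9" by (simp add: nat_less_iff)
    from omega_copy.le_peak_at[OF copy this]
    have "lambda_at (gamma1 k) i \<le> peak k (tail (right_of (gamma1 k) (?P * (i div ?P + 1)))) ?l" by simp
    also have "\<dots> \<le> ?M"
      using right_of_gamma1_bounds[of "i div ?P + 1" k] q silver1 \<rho> by (intro peak_mono) auto
    finally show ?thesis .
  next
    case 2
    \<comment> \<open>The first of the trailing 2s is the only block end outside the copies. Its
      right tail \<open>silver\<close> equals \<open>twos (2 * k) silver\<close>, which gives the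
      shape needed for \<open>le_peak\<close>.\<close>
    define x where "x = ones (twos (2 * k + 1) (ones (twos (2 * k) ?l)))"
    have x: "0 \<le> x" "x \<le> 1" unfolding x_def using l by (auto intro!: ones_range twos_range)
    have "?l = 1 - twos (2 * k) (twos 3 x)"
      using left_tail_eq[of k] ones_twos[OF x, of "2 * k + 2"] twos_add[of "2 * k" 3 x]
      by (simp add: cfv_rev_omega x_def numeral_3_eq_3)
    moreover have "lambda_at (gamma1 k) i = 2 + silver + ?l"
      using left_of_gamma1[of 2 k] 2
      by (simp add: lambda_at_eq[OF positive_gamma1] right_of_gamma1 gamma1_eq left_tail_def mult.commute)
    moreover have "3 + twos (2 * k) silver - twos (2 * k) (twos 3 x) \<le> ?M"
      using \<rho> l x silver_range twos_3_ge[OF x] inverse_2_plus_le[OF l(1)] by (intro le_peak) auto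
    ultimately show ?thesis using twos_silver by simp
  next
    case 3
    then have "lambda_at (gamma1 k) i \<le> 3"
      by (intro lambda_at_le_3 positive_gamma1) (auto simp: gamma1_eq)
    then show ?thesis using M3 by linarith
  qed
qed (rule lambda_at_gamma1_peak[OF assms])

lemma m_seq_eq: "1 \<le> k \<Longrightarrow> m_seq k = peak k (cfv (omega k) silver) (left_tail k)"
  by (simp add: m_seq_def markov_value_gamma1)

section \<open>Separating values, monotonicity and limit\<close>

definition omega_bar_value :: "nat \<Rightarrow> real" where
  "omega_bar_value k = peak k (right_tail k) (left_tail k)"

lemma omega_bar_value_in_lagrange: "1 \<le> k \<Longrightarrow> omega_bar_value k \<in> lagrange_spectrum"
  unfolding lagrange_spectrum_def
  using markov_value_omega_bar[of k] positive_omega_bar[of k] periodic_omega_bar[of k]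
  by (auto simp: omega_bar_value_def intro!: closure_subset[THEN subsetD])

text \<open>Both values are \<open>peak k\<close> with the same left tail; the right tails differ by
  \<open>right_tail_less\<close>.\<close>

lemma omega_bar_value_less_m_seq: "1 \<le> k \<Longrightarrow> omega_bar_value k < m_seq k"
  unfolding omega_bar_value_def
  using right_tail_less[of k] right_tail_range[of k] cfv_omega_range[of silver k] silver_range
  by (simp add: m_seq_eq peak_strict_mono)

lemma m_seq_Suc_less_omega_bar_value: "1 \<le> k \<Longrightarrow> m_seq (Suc k) < omega_bar_value k"
  unfolding omega_bar_value_def
  using right_tail_range[of k] cfv_omega_range[of silver "Suc k"] silver_range
    left_tail_range[of k] left_tail_range[of "Suc k"]
  by (simp add: m_seq_eq peak_Suc_less)

lemma strict_antimono_on_m_seq: "strict_antimono_on {1..} m_seq"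
proof (rule monotone_onI)
  fix x y :: nat assume "x \<in> {1..}" "x < y"
  then have "1 \<le> x" "Suc x \<le> y" by auto
  from this(2) show "m_seq y < m_seq x"
  proof (induction y rule: dec_induct)
    case base
    then show ?case
      using m_seq_Suc_less_omega_bar_value[OF \<open>1 \<le> x\<close>] omega_bar_value_less_m_seq[OF \<open>1 \<le> x\<close>] by linarith
  next
    case (step n)
    then show ?case
      using m_seq_Suc_less_omega_bar_value[of n] omega_bar_value_less_m_seq[of n] by linarith
  qed
qed

lemma m_seq_tendsto_3: "m_seq \<longlonglongrightarrow> 3"
proof (rule tendsto_sandwich)
  have bounds: "3 \<le> m_seq k \<and> m_seq k \<le> 3 + (1 / 4) ^ k" if "1 \<le> k" for k
  proof -
    note l = left_tail_range[of k]
    have \<rho>: "0 \<le> cfv (omega k) silver" "cfv (omega k) silver \<le> 1"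
      using cfv_omega_range[of silver k] silver_range by auto
    have "\<bar>twos (2 * k) (ones (twos (2 * k + 2) (ones (cfv (omega k) silver)))) - twos (2 * k) (1 / (2 + left_tail k))\<bar>
        \<le> (1 / 4) ^ (2 * k)"
      using \<rho> l by (intro twos_contraction) (auto intro!: ones_range twos_range)
    also have "(1 / 4 :: real) ^ (2 * k) \<le> (1 / 4) ^ k" by (intro power_decreasing) auto
    finally have "m_seq k \<le> 3 + (1 / 4) ^ k"
      using that by (simp add: m_seq_eq peak_def)
    then show ?thesis
      using three_le_peak[OF \<rho> l(1)] that by (simp add: m_seq_eq)
  qed
  show "\<forall>\<^sub>F k in sequentially. 3 \<le> m_seq k" "\<forall>\<^sub>F k in sequentially. m_seq k \<le> 3 + (1 / 4) ^ k"
    by (rule eventually_sequentiallyI[of 1], use bounds in blast)+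
  have "(\<lambda>k. 3 + (1 / 4 :: real) ^ k) \<longlonglongrightarrow> 3 + 0"
    by (intro tendsto_add tendsto_const LIMSEQ_power_zero) auto
  then show "(\<lambda>k. 3 + (1 / 4 :: real) ^ k) \<longlonglongrightarrow> 3" by simp
qed simp

lemma m_seq_in_markov_spectrum: "1 \<le> k \<Longrightarrow> m_seq k \<in> markov_spectrum"
  unfolding markov_spectrum_def using positive_gamma1[of k] markov_value_gamma1[of k] by (auto simp: m_seq_eq)

section \<open>Certified searches over windows\<close>

definition binary_word :: "(int \<Rightarrow> nat) \<Rightarrow> bool" where
  "binary_word \<theta> \<longleftrightarrow> (\<forall>n. \<theta> n = 1 \<or> \<theta> n = 2)"

lemma binary_imp_positive: "binary_word \<theta> \<Longrightarrow> positive_word \<theta>"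
  unfolding binary_word_def positive_word_def by (metis le_numeral_extra(4) one_le_numeral)

definition reads :: "(nat \<Rightarrow> nat) \<Rightarrow> bool list \<Rightarrow> bool" where
  "reads f xs \<longleftrightarrow> (\<forall>j<length xs. f j = (if xs ! j then 2 else 1))"

lemma reads_Nil [simp]: "reads f []"
  by (simp add: reads_def)

lemma reads_Cons: "reads f (x # xs) \<longleftrightarrow> f 0 = (if x then 2 else 1) \<and> reads (\<lambda>j. f (Suc j)) xs"
  unfolding reads_def length_Cons All_less_Suc2 by simp

lemma reads_snoc: "reads f (xs @ [x]) \<longleftrightarrow> reads f xs \<and> f (length xs) = (if x then 2 else 1)"
  unfolding reads_def length_append_singleton All_less_Suc by (auto simp: nth_append)

text \<open>Numerators and denominators of bounds for \<open>tail f\<close> when \<open>f\<close> starts with the given letters,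
  where \<open>True\<close> stands for the letter \<open>2\<close>; tails of words over \<open>{1, 2}\<close> lie in \<open>[1/3, 3/4]\<close>.\<close>

fun lower upper :: "bool list \<Rightarrow> int \<times> int" where
  "lower [] = (1, 3)"
| "lower (a # as) = (let (p, q) = upper as in (q, (if a then q + q + p else q + p)))"
| "upper [] = (3, 4)"
| "upper (a # as) = (let (p, q) = lower as in (q, (if a then q + q + p else q + p)))"

lemma tail_ge_third:
  assumes "\<And>j. f j = 1 \<or> f j = (2 :: nat)"
  shows "1 / 3 \<le> tail f"
proof -
  have pos: "1 \<le> f j" "f j \<le> 2" for j using assms[of j] by auto
  have t: "0 < tail (\<lambda>j. f (Suc j))" "tail (\<lambda>j. f (Suc j)) \<le> 1"
    using tail_bounds[of "\<lambda>j. f (Suc j)", OF pos(1)] by auto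
  have "1 / 3 \<le> 1 / (real (f 0) + tail (\<lambda>j. f (Suc j)))"
    using t pos[of 0] by (intro divide_left_mono mult_pos_pos add_nonneg_pos) auto
  then show ?thesis using tail_rec[of f, OF pos(1)] by simp
qed

lemma lower_upper_sound:
  assumes "\<And>j. f j = 1 \<or> f j = (2 :: nat)" "reads f xs"
  shows "(case lower xs of (p, q) \<Rightarrow> 0 < p \<and> 0 < q \<and> real_of_int p / real_of_int q \<le> tail f) \<and>
    (case upper xs of (p, q) \<Rightarrow> 0 < p \<and> 0 < q \<and> tail f \<le> real_of_int p / real_of_int q)"
  using assms
proof (induction xs arbitrary: f)
  case Nil
  have pos: "1 \<le> f j" for j using Nil(1)[of j] by auto
  have "1 / 3 \<le> tail (\<lambda>j. f (Suc j))" by (rule tail_ge_third) (rule Nil)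
  \<comment> \<open>The lower bound 1/3 for the next tail improves the trivial upper bound 1 to
    \<open>1 / (1 + 1/3)\<close>.\<close>
  then have "1 / (real (f 0) + tail (\<lambda>j. f (Suc j))) \<le> 1 / (4 / 3)"
    using pos[of 0] by (intro divide_left_mono mult_pos_pos add_nonneg_pos) auto
  then have "tail f \<le> 3 / 4" using tail_rec[of f, OF pos] by simp
  moreover have "1 / 3 \<le> tail f" by (rule tail_ge_third) (rule Nil)
  ultimately show ?case by simp
next
  case (Cons a xs)
  define t where "t = tail (\<lambda>j. f (Suc j))"
  obtain p q where lo: "lower xs = (p, q)" by fastforce
  obtain p' q' where hi: "upper xs = (p', q')" by fastforce
  have pos: "1 \<le> f j" for j using Cons.prems(1)[of j] by auto
  have f0: "f 0 = (if a then 2 else 1)" and rd: "reads (\<lambda>j. f (Suc j)) xs"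
    using Cons.prems(2) by (auto simp: reads_Cons)
  have tf: "tail f = 1 / (real (if a then 2 else 1) + t)"
    using tail_rec[of f, OF pos] f0 by (simp add: t_def)
  have IH: "0 < p" "0 < q" "real_of_int p / real_of_int q \<le> t"
    "0 < p'" "0 < q'" "t \<le> real_of_int p' / real_of_int q'"
    using Cons.IH[of "\<lambda>j. f (Suc j)", OF Cons.prems(1) rd] by (auto simp: lo hi t_def)
  define d :: real where "d = real (if a then 2 else 1)"
  have d: "0 < d" by (simp add: d_def)
  have t0: "0 < real_of_int p / real_of_int q" using IH by simp
  then have t1: "0 < t" using IH(3) by linarith
  have "1 / (d + real_of_int p' / real_of_int q') \<le> 1 / (d + t)"
    "1 / (d + t) \<le> 1 / (d + real_of_int p / real_of_int q)"
    using d t0 t1 IH(3,6) by (intro divide_left_mono mult_pos_pos add_pos_pos; linarith)+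
  moreover have "1 / (d + real_of_int p' / real_of_int q') = real_of_int q' / (d * real_of_int q' + real_of_int p')"
    "1 / (d + real_of_int p / real_of_int q) = real_of_int q / (d * real_of_int q + real_of_int p)"
    using IH by (simp_all add: add_divide_eq_iff)
  ultimately have "real_of_int q' / (d * real_of_int q' + real_of_int p') \<le> tail f"
    "tail f \<le> real_of_int q / (d * real_of_int q + real_of_int p)"
    unfolding tf d_def[symmetric] by simp_all
  then show ?case using IH by (cases a) (simp_all add: lo hi d_def add_ac)
qed

text \<open>A window \<open>(ls, rs)\<close> around a position lists the letters to its left, nearest first, and the
  letters from that position on.\<close>

definition window_at :: "(int \<Rightarrow> nat) \<Rightarrow> int \<Rightarrow> bool list \<times> bool list \<Rightarrow> bool" where
  "window_at \<theta> c w \<longleftrightarrow> reads (left_of \<theta> c) (fst w) \<and> reads (right_of \<theta> c) (snd w)"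

text \<open>Leaving the window gives the empty window, which is correct at every position and on
  which \<open>above\<close> is \<open>False\<close>. A wrong distance in a certificate can thus
  only make the check fail.\<close>

fun move_left :: "nat \<Rightarrow> bool list \<times> bool list \<Rightarrow> bool list \<times> bool list" where
  "move_left 0 w = w"
| "move_left (Suc n) (l # ls, rs) = move_left n (ls, l # rs)"
| "move_left (Suc n) ([], rs) = ([], [])"

fun move_right :: "nat \<Rightarrow> bool list \<times> bool list \<Rightarrow> bool list \<times> bool list" where
  "move_right 0 w = w"
| "move_right (Suc n) (ls, r # rs) = move_right n (r # ls, rs)"
| "move_right (Suc n) (ls, []) = ([], [])"

lemma reads_left_of_Cons:
  "reads (left_of \<theta> c) (l # ls) \<longleftrightarrow> \<theta> (c - 1) = (if l then 2 else 1) \<and> reads (left_of \<theta> (c - 1)) ls"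
proof -
  have "(\<lambda>j. left_of \<theta> c (Suc j)) = left_of \<theta> (c - 1)" by (auto simp: left_of_def diff_diff_eq add.assoc)
  then show ?thesis by (simp add: reads_Cons) (simp add: left_of_def)
qed

lemma reads_right_of_Cons:
  "reads (right_of \<theta> c) (r # rs) \<longleftrightarrow> \<theta> c = (if r then 2 else 1) \<and> reads (right_of \<theta> (c + 1)) rs"
proof -
  have "(\<lambda>j. right_of \<theta> c (Suc j)) = right_of \<theta> (c + 1)" by (auto simp: right_of_def add.assoc)
  then show ?thesis by (simp add: reads_Cons) (simp add: right_of_def)
qed

lemma window_at_move_left: "window_at \<theta> c w \<Longrightarrow> window_at \<theta> (c - int n) (move_left n w)"
proof (induction n w arbitrary: c rule: move_left.induct)
  case (2 n l ls rs)
  then have "window_at \<theta> (c - 1) (ls, l # rs)"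
    by (simp add: window_at_def reads_left_of_Cons reads_right_of_Cons)
  from 2(1)[OF this] show ?case by (simp add: algebra_simps)
qed (simp_all add: window_at_def)

lemma window_at_move_right: "window_at \<theta> c w \<Longrightarrow> window_at \<theta> (c + int n) (move_right n w)"
proof (induction n w arbitrary: c rule: move_right.induct)
  case (2 n ls r rs)
  then have "window_at \<theta> (c + 1) (r # ls, rs)"
    by (simp add: window_at_def reads_left_of_Cons reads_right_of_Cons)
  from 2(1)[OF this] show ?case by (simp add: algebra_simps)
qed (simp_all add: window_at_def)

text \<open>The pair \<open>(m, n)\<close> stands for the threshold \<open>2 + m / n\<close>, where
  the 2 is the central letter. Fractions are cross-multiplied so that evaluation stays within the
  integers.\<close>

fun above :: "int \<times> int \<Rightarrow> bool list \<times> bool list \<Rightarrow> bool" where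
  "above (m, n) (ls, True # rs) =
     (let (p, q) = lower ls; (p', q') = lower rs in m * (q * q') < n * (p * q' + p' * q))"
| "above _ _ = False"

fun below :: "int \<times> int \<Rightarrow> bool list \<times> bool list \<Rightarrow> bool" where
  "below (m, n) (ls, True # rs) =
     (let (p, q) = upper ls; (p', q') = upper rs in n * (p * q' + p' * q) < m * (q * q'))"
| "below _ _ = False"

definition offset :: "int \<times> int \<Rightarrow> real" where
  "offset t = 2 + real_of_int (fst t) / real_of_int (snd t)"

lemma divide_less_divide_iff: "0 < b \<Longrightarrow> 0 < d \<Longrightarrow> a / b < c / d \<longleftrightarrow> a * d < c * (b :: real)"
  by (simp add: pos_divide_less_eq pos_less_divide_eq)

lemma frac_sum:
  "0 < q \<Longrightarrow> 0 < q' \<Longrightarrow> real_of_int p / real_of_int q + real_of_int p' / real_of_int q'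
    = real_of_int (p * q' + p' * q) / real_of_int (q * q')"
  by (simp add: add_frac_eq)

lemma above_below_sound:
  assumes "binary_word \<theta>" "window_at \<theta> c w" "0 < snd t"
  shows "above t w \<Longrightarrow> offset t < lambda_at \<theta> c"
    and "below t w \<Longrightarrow> lambda_at \<theta> c < offset t"
proof -
  obtain m n where t: "t = (m, n)" by fastforce
  have n: "0 < n" using assms(3) t by simp
  have binary: "left_of \<theta> c j = 1 \<or> left_of \<theta> c j = 2" "right_of \<theta> c j = 1 \<or> right_of \<theta> c j = 2" for j c
    using assms(1) by (auto simp: binary_word_def left_of_def right_of_def)
  obtain ls r rs where w: "w = (ls, r # rs) \<or> \<not> above t w \<and> \<not> below t w"
    by (cases w; cases "snd w") (auto simp: t)
  show "offset t < lambda_at \<theta> c" if "above t w"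
  proof -
    have w: "w = (ls, True # rs)" using w that by (cases r) (auto simp: t)
    then have rd: "reads (left_of \<theta> c) ls" "reads (right_of \<theta> (c + 1)) rs" and c: "\<theta> c = 2"
      using assms(2) by (auto simp: window_at_def reads_right_of_Cons)
    obtain p q where pq: "lower ls = (p, q)" by fastforce
    obtain p' q' where pq': "lower rs = (p', q')" by fastforce
    have l: "0 < q" "real_of_int p / real_of_int q \<le> tail (left_of \<theta> c)"
      and r: "0 < q'" "real_of_int p' / real_of_int q' \<le> tail (right_of \<theta> (c + 1))"
      using lower_upper_sound[of "left_of \<theta> c", OF binary(1) rd(1)]
        lower_upper_sound[of "right_of \<theta> (c + 1)", OF binary(2) rd(2)] pq pq' by auto
    have "m * (q * q') < (p * q' + p' * q) * n"
      using that by (simp add: w t pq pq' mult.commute)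
    then have "real_of_int (m * (q * q')) < real_of_int ((p * q' + p' * q) * n)"
      by (simp only: of_int_less_iff)
    then have "real_of_int m / real_of_int n < real_of_int (p * q' + p' * q) / real_of_int (q * q')"
      using n l(1) r(1) by (subst divide_less_divide_iff) simp_all
    then show ?thesis
      using l r lambda_at_eq[OF binary_imp_positive[OF assms(1)], of c] frac_sum[OF l(1) r(1), of p p']
      by (simp add: offset_def t c)
  qed
  show "lambda_at \<theta> c < offset t" if "below t w"
  proof -
    have w: "w = (ls, True # rs)" using w that by (cases r) (auto simp: t)
    then have rd: "reads (left_of \<theta> c) ls" "reads (right_of \<theta> (c + 1)) rs" and c: "\<theta> c = 2"
      using assms(2) by (auto simp: window_at_def reads_right_of_Cons)
    obtain p q where pq: "upper ls = (p, q)" by fastforce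
    obtain p' q' where pq': "upper rs = (p', q')" by fastforce
    have l: "0 < q" "tail (left_of \<theta> c) \<le> real_of_int p / real_of_int q"
      and r: "0 < q'" "tail (right_of \<theta> (c + 1)) \<le> real_of_int p' / real_of_int q'"
      using lower_upper_sound[of "left_of \<theta> c", OF binary(1) rd(1)]
        lower_upper_sound[of "right_of \<theta> (c + 1)", OF binary(2) rd(2)] pq pq' by auto
    have "(p * q' + p' * q) * n < m * (q * q')"
      using that by (simp add: w t pq pq' mult.commute)
    then have "real_of_int ((p * q' + p' * q) * n) < real_of_int (m * (q * q'))"
      by (simp only: of_int_less_iff)
    then have "real_of_int (p * q' + p' * q) / real_of_int (q * q') < real_of_int m / real_of_int n"
      using n l(1) r(1) by (subst divide_less_divide_iff) simp_all
    then show ?thesis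
      using l r lambda_at_eq[OF binary_imp_positive[OF assms(1)], of c] frac_sum[OF l(1) r(1), of p p']
      by (simp add: offset_def t c)
  qed
qed

text \<open>A certificate is a search tree over windows: a branch is closed when the value at the centre is
  too low, or when the value at some letter a given distance from the centre is too high.\<close>

datatype certificate = Found | Low | High_left nat | High_right nat
  | Extend_left certificate certificate | Extend_right certificate certificate

fun search :: "int \<times> int \<Rightarrow> int \<times> int \<Rightarrow> (bool list \<times> bool list \<Rightarrow> bool) \<Rightarrow> bool list \<times> bool list
    \<Rightarrow> certificate \<Rightarrow> bool" where
  "search T B P w Found = P w"
| "search T B P w Low = below B w"
| "search T B P w (High_left n) = above T (move_left n w)"
| "search T B P w (High_right n) = above T (move_right n w)"
| "search T B P (ls, rs) (Extend_left c d) =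
     (search T B P (ls @ [False], rs) c \<and> search T B P (ls @ [True], rs) d)"
| "search T B P (ls, rs) (Extend_right c d) =
     (search T B P (ls, rs @ [False]) c \<and> search T B P (ls, rs @ [True]) d)"

text \<open>The threshold \<open>T\<close> bounds the values at all letters, \<open>B\<close> only
  the value at the centre from below. So every leaf other than \<open>Found\<close> contradicts an
  assumption, and an extension splits on a letter that can only be 1 or 2.\<close>

lemma search_sound:
  assumes "binary_word \<theta>" "0 < snd T" "0 < snd B"
    "\<And>i. lambda_at \<theta> i \<le> offset T" "offset B \<le> lambda_at \<theta> c"
  shows "search T B P w cert \<Longrightarrow> window_at \<theta> c w \<Longrightarrow> \<exists>w'. P w' \<and> window_at \<theta> c w'"
proof (induction cert arbitrary: w)
  case Found
  then show ?case by (intro exI[of _ w]) simp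
next
  case Low
  then have "below B w" by simp
  from above_below_sound(2)[OF assms(1) Low(2) assms(3) this] show ?case using assms(5) by simp
next
  case (High_left n)
  then have "above T (move_left n w)" by simp
  from above_below_sound(1)[OF assms(1) window_at_move_left[OF High_left(2)] assms(2) this]
  show ?case using assms(4)[of "c - int n"] by simp
next
  case (High_right n)
  then have "above T (move_right n w)" by simp
  from above_below_sound(1)[OF assms(1) window_at_move_right[OF High_right(2)] assms(2) this]
  show ?case using assms(4)[of "c + int n"] by simp
next
  case (Extend_left c1 c2)
  obtain ls rs where w: "w = (ls, rs)" by fastforce
  have "left_of \<theta> c (length ls) = 1 \<or> left_of \<theta> c (length ls) = 2"
    using assms(1) by (simp add: binary_word_def left_of_def)
  then have "window_at \<theta> c (ls @ [False], rs) \<or> window_at \<theta> c (ls @ [True], rs)"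
    using Extend_left.prems(2) by (simp add: w window_at_def reads_snoc)
  moreover have "search T B P (ls @ [False], rs) c1" "search T B P (ls @ [True], rs) c2"
    using Extend_left.prems(1) by (simp_all add: w)
  ultimately show ?case using Extend_left.IH by metis
next
  case (Extend_right c1 c2)
  obtain ls rs where w: "w = (ls, rs)" by fastforce
  have "right_of \<theta> c (length rs) = 1 \<or> right_of \<theta> c (length rs) = 2"
    using assms(1) by (simp add: binary_word_def right_of_def)
  then have "window_at \<theta> c (ls, rs @ [False]) \<or> window_at \<theta> c (ls, rs @ [True])"
    using Extend_right.prems(2) by (simp add: w window_at_def reads_snoc)
  moreover have "search T B P (ls, rs @ [False]) c1" "search T B P (ls, rs @ [True]) c2"
    using Extend_right.prems(1) by (simp_all add: w)
  ultimately show ?case using Extend_right.IH by metis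
qed

section \<open>Self-replicating windows in periodic words\<close>

definition contains_left :: "nat \<Rightarrow> bool list \<times> bool list \<Rightarrow> bool list \<times> bool list \<Rightarrow> bool" where
  "contains_left n v w \<longleftrightarrow>
     (case move_left n w of (ls, rs) \<Rightarrow> take (length (fst v)) ls = fst v \<and> take (length (snd v)) rs = snd v)"

lemma reads_take: "reads f xs \<Longrightarrow> reads f (take n xs)"
  by (simp add: reads_def)

lemma window_at_contains_left:
  "contains_left n v w \<Longrightarrow> window_at \<theta> c w \<Longrightarrow> window_at \<theta> (c - int n) v"
proof -
  assume *: "contains_left n v w" "window_at \<theta> c w"
  obtain ls rs where m: "move_left n w = (ls, rs)" by fastforce
  have v: "fst v = take (length (fst v)) ls" "snd v = take (length (snd v)) rs"
    using *(1) by (simp_all add: contains_left_def m)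
  have "reads (left_of \<theta> (c - int n)) ls" "reads (right_of \<theta> (c - int n)) rs"
    using window_at_move_left[OF *(2), of n] by (simp_all add: m window_at_def)
  then show "window_at \<theta> (c - int n) v"
    unfolding window_at_def by (subst v, subst v(2)) (simp add: reads_take)
qed

definition window :: "(int \<Rightarrow> nat) \<Rightarrow> int \<Rightarrow> nat \<Rightarrow> nat \<Rightarrow> bool list \<times> bool list" where
  "window \<theta> c m n = (map (\<lambda>j. left_of \<theta> c j = 2) [0..<m], map (\<lambda>j. right_of \<theta> c j = 2) [0..<n])"

lemma window_at_window: "binary_word \<theta> \<Longrightarrow> window_at \<theta> c (window \<theta> c m n)"
  unfolding window_at_def window_def reads_def binary_word_def left_of_def right_of_def by force

text \<open>The word \<open>1_2 2_{2k+2} 1_2 omega omega 2_{2k}\<close>, centred at the peak of the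
  first full copy; it ends just before \<open>gamma1 k\<close> leaves \<open>omega_bar k\<close>. In
  the second tree of each certificate it is extended only to the left: a wrong letter makes the
  value too high at the centre or at an end of the block \<open>2_{2k+1}\<close> one period earlier,
  at distance \<open>4 * k + 9\<close> or \<open>6 * k + 9\<close>.\<close>

definition self_replicating_window :: "nat \<Rightarrow> bool list \<times> bool list" where
  "self_replicating_window k = window (omega_bar k) (int (2 * k + 2)) (4 * k + 8) (12 * k + 16)"

text \<open>The extra letter is the first one at which \<open>gamma1 k\<close> departs from \<open>omega_bar k\<close>.\<close>

definition central_window :: "nat \<Rightarrow> bool list \<times> bool list" where
  "central_window k = (case self_replicating_window k of (ls, rs) \<Rightarrow> (ls, rs @ [True]))"

lemma periodic_shift:
  assumes "\<And>n. \<theta> (n + p) = \<theta> n"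
  shows "left_of \<theta> (c + int m * p) = left_of \<theta> c" "right_of \<theta> (c + int m * p) = right_of \<theta> c"
proof -
  have *: "\<theta> (n + int m * p) = \<theta> n" for n
  proof (induction m)
    case (Suc m)
    then show ?case using assms[of "n + int m * p"] by (simp add: algebra_simps)
  qed simp
  have "\<theta> (c + int m * p - 1 - int j) = \<theta> (c - 1 - int j)" for j
    using *[of "c - 1 - int j"] by (simp add: algebra_simps)
  then show "left_of \<theta> (c + int m * p) = left_of \<theta> c" by (simp add: left_of_def)
  have "\<theta> (c + int m * p + int j) = \<theta> (c + int j)" for j
    using *[of "c + int j"] by (simp add: algebra_simps)
  then show "right_of \<theta> (c + int m * p) = right_of \<theta> c" by (simp add: right_of_def)
qed

lemma lambda_at_nonneg: "positive_word \<theta> \<Longrightarrow> 0 \<le> lambda_at \<theta> c"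
  using tail_right_of_bounds(1)[of \<theta> "c + 1"] tail_left_of_bounds(1)[of \<theta> c] by (simp add: lambda_at_eq)

text \<open>The window of \<open>omega_bar k\<close> reproduces itself one period to the left, so by periodicity it also
  appears one period to the right of \<open>c\<close>, where it contradicts the last letter of the central window.\<close>

lemma no_periodic_word_with_central_window:
  assumes \<theta>: "binary_word \<theta>" "periodic_word \<theta>" "\<And>i. lambda_at \<theta> i \<le> offset T"
    and T: "0 < snd T"
    and repl: "search T (-2, 1) (contains_left (6 * k + 9) (self_replicating_window k))
      (self_replicating_window k) cert"
    and c: "window_at \<theta> c (central_window k)"
  shows False
proof -
  define P where "P = int (6 * k + 9)"
  let ?W = "self_replicating_window k"
  obtain ls rs where W: "?W = (ls, rs)" by fastforce
  have len: "length rs = 12 * k + 16" using W by (auto simp: self_replicating_window_def window_def)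
  obtain p where p: "0 < p" "\<And>n. \<theta> (n + p) = \<theta> n" using \<theta>(2) by (auto simp: periodic_word_def)
  have step: "window_at \<theta> (d - P) ?W" if "window_at \<theta> d ?W" for d
  proof -
    have "offset (-2, 1) \<le> lambda_at \<theta> d"
      using lambda_at_nonneg[OF binary_imp_positive[OF \<theta>(1)], of d] by (simp add: offset_def)
    from search_sound[OF \<theta>(1) T _ \<theta>(3) this repl that] show ?thesis
      using window_at_contains_left unfolding P_def by fastforce
  qed
  have "window_at \<theta> (c - int n * P) ?W" for n
  proof (induction n)
    case 0
    then show ?case using c by (simp add: central_window_def W window_at_def reads_snoc)
  next
    case (Suc n)
    from step[OF this] show ?case by (simp add: algebra_simps)
  qed
  \<comment> \<open>With \<open>p - 1\<close> steps of length \<open>P\<close> to the left, moving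
    right by \<open>P * p\<close>, a multiple of the period, ends at \<open>c + P\<close>.\<close>
  from this[of "nat p - 1"] have "window_at \<theta> (c - (p - 1) * P) ?W" using p(1) by (simp add: of_nat_diff)
  moreover have shift: "c - (p - 1) * P + int (6 * k + 9) * p = c + P"
    by (simp add: P_def algebra_simps)
  ultimately have "window_at \<theta> (c + P) ?W"
    using periodic_shift[of \<theta> p, OF p(2), of "c - (p - 1) * P" "6 * k + 9"]
    unfolding shift window_at_def by simp
  \<comment> \<open>This letter stands at \<open>c + 12 * k + 16\<close>, the place of the extra
    letter 2 of the central window, while the shifted copy of the window has there the first 1 after
    its initial \<open>2_{2k}\<close>.\<close>
  then have "right_of \<theta> (c + P) (6 * k + 7) = (if rs ! (6 * k + 7) then 2 else 1)"
    by (simp add: window_at_def W reads_def len)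
  moreover have "\<not> rs ! (6 * k + 7)"
  proof -
    have "rs ! (6 * k + 7) = (omega_bar k (int (2 * k + 2) + int (6 * k + 7)) = 2)"
      using W by (auto simp: self_replicating_window_def window_def right_of_def)
    also have "int (2 * k + 2) + int (6 * k + 7) = int (6 * k + 9) * 1 + int (2 * k)" by simp
    also have "omega_bar k (int (6 * k + 9) * 1 + int (2 * k)) = 1"
      by (subst omega_bar_copy) (simp_all add: omega_nth)
    finally show ?thesis by simp
  qed
  moreover have "right_of \<theta> c (12 * k + 16) = 2"
    using c by (simp add: central_window_def W window_at_def reads_snoc len)
  moreover have "right_of \<theta> (c + P) (6 * k + 7) = right_of \<theta> c (12 * k + 16)"
    by (simp add: right_of_def P_def algebra_simps)
  ultimately show False by simp
qed

text \<open>The second threshold of the last search is vacuous: \<open>offset (-2, 1) = 0\<close>.\<close>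

definition certifies :: "nat \<Rightarrow> int \<times> int \<Rightarrow> int \<times> int \<Rightarrow> certificate \<Rightarrow> certificate \<Rightarrow> bool" where
  "certifies k T B cert cert' \<longleftrightarrow>
     0 < snd T \<and> 10 * fst T \<le> 11 * snd T \<and> 0 < snd B \<and> snd B \<le> fst B \<and>
     above B (window (gamma1 k) (int (2 * k + 2)) (20 * k + 20) (20 * k + 20)) \<and>
     below T (window (gamma1 k) (int (2 * k + 2)) (20 * k + 20) (20 * k + 20)) \<and>
     search T B (contains_left 0 (central_window k)) ([False], [True, True]) cert \<and>
     search T (-2, 1) (contains_left (6 * k + 9) (self_replicating_window k)) (self_replicating_window k) cert'"

section \<open>From certificates to gaps in the Lagrange spectrum\<close>

lemma binary_if_lambda_at_le:
  assumes "positive_word \<theta>" "\<And>i. lambda_at \<theta> i \<le> 31 / 10"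
  shows "binary_word \<theta>"
  unfolding binary_word_def
proof
  fix n
  note lam = lambda_at_eq[OF assms(1)]
  \<comment> \<open>In two rounds: positive tails give letters at most 3, hence tails at least 1/4,
    hence letters at most \<open>3.1 - 1/2\<close>, which is below 3.\<close>
  have "real (\<theta> i) < 4" for i
    using assms(2)[of i] lam[of i] tail_right_of_bounds(1)[OF assms(1), of "i + 1"]
      tail_left_of_bounds(1)[OF assms(1), of i] by linarith
  then have le3: "\<theta> i \<le> 3" for i by (metis not_less_eq_eq of_nat_less_numeral_iff less_Suc_eq_le numeral_eq_Suc pred_numeral_simps(2) semiring_norm(26,27))
  then have "1 / 4 \<le> 1 / real (\<theta> i + 1)" for i
    by (intro divide_left_mono) (use le3[of i] in auto)
  then have "1 / 4 \<le> tail (right_of \<theta> (n + 1))" "1 / 4 \<le> tail (left_of \<theta> n)"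
    using tail_right_of_bounds(3)[OF assms(1), of "n + 1"] tail_left_of_bounds(3)[OF assms(1), of n]
    by (meson order_trans)+
  then have "real (\<theta> n) < 3" using assms(2)[of n] lam[of n] by linarith
  moreover have "1 \<le> \<theta> n" using assms(1) by (auto simp: positive_word_def)
  ultimately show "\<theta> n = 1 \<or> \<theta> n = 2" by linarith
qed

lemma three_less_lambda_at_imp_neighbours:
  assumes "binary_word \<theta>" "\<And>i. lambda_at \<theta> i \<le> 31 / 10" "3 < lambda_at \<theta> c"
  shows "\<theta> c = 2" "\<theta> (c - 1) = 1 \<and> \<theta> (c + 1) = 2 \<or> \<theta> (c - 1) = 2 \<and> \<theta> (c + 1) = 1"
proof -
  note pos = binary_imp_positive[OF assms(1)]
  have two: "\<theta> i = 1 \<or> \<theta> i = 2" for i using assms(1) by (simp add: binary_word_def)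
  show c: "\<theta> c = 2" using two[of c] lambda_at_le_3[OF pos, of c] assms(3) by auto
  have False if "\<theta> (c - 1) = 1" "\<theta> (c + 1) = 1"
  proof -
    have "window_at \<theta> c ([False], [True, False])"
      using c that by (simp add: window_at_def reads_left_of_Cons reads_right_of_Cons)
    \<comment> \<open>A 2 between two 1s has both tails at least \<open>1 / (1 + 3/4) = 4/7\<close>,
      so its value is at least \<open>2 + 8/7\<close>, above 3.1.\<close>
    from above_below_sound(1)[OF assms(1) this, of "(11, 10)"] show False
      using assms(2)[of c] by (simp add: offset_def)
  qed
  moreover have False if "\<theta> (c - 1) = 2" "\<theta> (c + 1) = 2"
    using lambda_at_le_3[OF pos, of c] c that assms(3) by simp
  ultimately show "\<theta> (c - 1) = 1 \<and> \<theta> (c + 1) = 2 \<or> \<theta> (c - 1) = 2 \<and> \<theta> (c + 1) = 1"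
    using two[of "c - 1"] two[of "c + 1"] by blast
qed

lemma certified_not_in_lagrange_spectrum:
  assumes k: "1 \<le> k" and cert: "certifies k T B cert cert'"
  shows "m_seq k \<notin> lagrange_spectrum"
proof -
  have T: "0 < snd T" "offset T \<le> 31 / 10" and B: "0 < snd B" "3 \<le> offset B"
    using cert by (simp_all add: certifies_def offset_def field_simps flip: of_int_mult)
  have False if \<theta>: "binary_word \<theta>" "periodic_word \<theta>" "\<And>i. lambda_at \<theta> i \<le> offset T"
    "offset B < lambda_at \<theta> c" "\<theta> (c - 1) = 1" "\<theta> c = 2" "\<theta> (c + 1) = 2" for \<theta> c
  proof -
    have "window_at \<theta> c ([False], [True, True])"
      using \<theta>(5-7) by (simp add: window_at_def reads_left_of_Cons reads_right_of_Cons)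
    from search_sound[OF \<theta>(1) T(1) B(1) \<theta>(3) less_imp_le[OF \<theta>(4)] _ this] cert
    obtain w where "contains_left 0 (central_window k) w" "window_at \<theta> c w"
      unfolding certifies_def by blast
    from window_at_contains_left[OF this] have "window_at \<theta> c (central_window k)" by simp
    with no_periodic_word_with_central_window[OF \<theta>(1-3) T(1)] cert show False
      unfolding certifies_def by blast
  qed
  note no_word = this
  \<comment> \<open>The supremum exceeds \<open>offset B\<close>, so some letter does; this letter
    becomes the centre of the search. All letters stay below \<open>offset T\<close>.\<close>
  have gap: "x \<le> offset B \<or> offset T \<le> x"
    if \<theta>: "positive_word \<theta>" "periodic_word \<theta>" and x: "markov_value \<theta> = ereal x" for \<theta> x
  proof (rule ccontr)
    assume "\<not> (x \<le> offset B \<or> offset T \<le> x)"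
    then have Bx: "offset B < x" and xT: "x < offset T" by auto
    have "ereal (lambda_at \<theta> i) \<le> ereal x" for i
      unfolding x[symmetric] markov_value_def by (rule SUP_upper) simp
    then have lam: "lambda_at \<theta> i \<le> offset T" for i using xT by (meson ereal_less_eq(3) less_imp_le order_trans)
    then have lam': "lambda_at \<theta> i \<le> 31 / 10" for i using T(2) order_trans by blast
    have "ereal (offset B) < (SUP i. ereal (lambda_at \<theta> i))"
      using Bx x unfolding markov_value_def by simp
    then obtain c where c: "offset B < lambda_at \<theta> c" by (auto simp: less_SUP_iff)
    have bin: "binary_word \<theta>" by (rule binary_if_lambda_at_le[OF \<theta>(1) lam'])
    have "3 < lambda_at \<theta> c" using c B(2) by linarith
    note nb = three_less_lambda_at_imp_neighbours[OF bin lam' this]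
    from nb(2) show False
    proof
      assume "\<theta> (c - 1) = 1 \<and> \<theta> (c + 1) = 2"
      then show False using no_word[OF bin \<theta>(2) lam c] nb(1) by simp
    next
      \<comment> \<open>The root of the search has the 1 on the left of the centre. The other
        orientation is reduced to it by reflecting the word.\<close>
      assume *: "\<theta> (c - 1) = 2 \<and> \<theta> (c + 1) = 1"
      let ?\<theta> = "\<lambda>n. \<theta> (- n)"
      obtain p where p: "0 < p" "\<And>n. \<theta> (n + p) = \<theta> n" using \<theta>(2) by (auto simp: periodic_word_def)
      have "?\<theta> (n + p) = ?\<theta> n" for n using p(2)[of "- n - p"] by simp
      then have per: "periodic_word ?\<theta>" using p(1) unfolding periodic_word_def by blast
      have bin': "binary_word ?\<theta>" using bin by (simp add: binary_word_def)
      show False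
        using no_word[OF bin' per, of "- c"] lam c nb(1) *
        by (simp add: lambda_at_reflect[OF \<theta>(1)] add.commute)
    qed
  qed
  have bin: "binary_word (gamma1 k)"
    unfolding binary_word_def gamma1_eq omega_bar_def
    by (auto simp: omega_nth nat_less_iff)
  note win = window_at_window[OF bin, of "int (2 * k + 2)" "20 * k + 20" "20 * k + 20"]
  \<comment> \<open>The peak of \<open>gamma1 k\<close> has exactly the value
    \<open>m_seq k\<close>; \<open>20 * k + 20\<close> letters on each side locate it between the
    thresholds.\<close>
  have "offset B < m_seq k" "m_seq k < offset T"
    using above_below_sound(1)[OF bin win B(1)] above_below_sound(2)[OF bin win T(1)] cert
    unfolding certifies_def m_seq_eq[OF k] lambda_at_gamma1_peak[OF k, symmetric] by blast+
  \<comment> \<open>An open interval that misses the periodic Markov values also misses their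
    closure.\<close>
  moreover have "{offset B<..<offset T} \<inter> lagrange_spectrum = {}"
  proof -
    have "x \<notin> {offset B<..<offset T}"
      if "\<exists>\<theta>. positive_word \<theta> \<and> periodic_word \<theta> \<and> markov_value \<theta> = ereal x" for x
      using that gap by fastforce
    then show ?thesis
      unfolding lagrange_spectrum_def open_Int_closure_eq_empty[OF open_greaterThanLessThan] by blast
  qed
  ultimately show ?thesis by auto
qed

section \<open>The main theorem\<close>

text \<open>The trees were found by extending the window on the side that contributes the larger
  uncertainty; \<open>offset B\<close> and \<open>offset T\<close> are the simplest fractions below and above \<open>m_seq k\<close> whose
  distance to it is less than \<open>m_seq k - omega_bar_value k\<close>.\<close>

lemma certificate_1: "certifies 1 (2088188735, 2076586199) (366397201, 364361400)
    (Extend_left (Extend_left (Extend_right (Extend_right (Extend_left (Extend_right Low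
    (Extend_left (Extend_left (Extend_right (High_right 4) Low) (High_right 0)) Low)) (High_right
    0)) (High_right 1)) (High_right 0)) (Extend_right Low (Extend_left Low (Extend_right
    (Extend_right (Extend_left (Extend_right (High_right 0) (Extend_left (Extend_right (High_right
    5) (Extend_left (High_right 0) (Extend_left (High_left 7) (Extend_right (High_right 0)
    (Extend_right (Extend_left (Extend_right (Extend_left (Extend_right Low (Extend_left
    (Extend_left (Extend_right (High_right 10) Low) (High_right 0)) Low)) (High_right 0))
    (High_right 5)) Low) (Extend_left (High_right 0) (Extend_right (Extend_left Low (Extend_right
    (Extend_left (Extend_right (High_right 0) (Extend_left (Extend_right (High_right 11)
    (Extend_left (High_right 0) (Extend_left Low (Extend_right (Extend_right (Extend_left
    (High_right 0) (Extend_right (High_right 0) (Extend_left (Extend_right Low (Extend_left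
    (Extend_right (Extend_left (High_left 15) (High_right 0)) (Extend_left Low (Extend_left
    (High_right 0) (Extend_right (Extend_right (Extend_left (Extend_right Low (Extend_left
    (Extend_right (High_right 20) (Extend_left Low (Extend_left (High_left 22) (Extend_right Low
    (Extend_right (Extend_left (High_left 15) (High_right 0)) (Extend_left Low (Extend_right
    (Extend_left (High_right 0) (Extend_right (Extend_left (Extend_right Low (Extend_left
    (Extend_right (High_right 26) (Extend_left Low (Extend_left (High_left 28) (Extend_right Low
    Found)))) Low)) (Extend_right (High_right 15) (High_right 0))) Low)) (High_right 0)))))))) Low))
    (Extend_right (High_right 15) (High_right 0))) Low) (High_right 0))))) Low)) (Extend_right
    (High_right 15) (High_right 0))))) (High_right 0)) Low)))) (High_right 0))) (Extend_right
    (High_right 8) Low)) (High_right 0))) Low))))))) (High_right 0))) (Extend_right (High_right 2)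
    Low)) (High_right 0)) Low)))) (High_right 0))
    (Extend_left (High_right 0) (Extend_left (High_left 13) (Extend_left (High_right 0) (Extend_left
    (Extend_left (Extend_left (High_left 15) (Extend_left (High_right 0) (Extend_left (Extend_left
    (Extend_left (High_left 15) (Extend_left (High_right 0) (Extend_left (High_left 15) (Extend_left
    (High_right 0) (Extend_left (Extend_left Found (High_left 15)) (High_right 0)))))) (High_left
    15)) (High_right 0)))) (High_left 13)) (High_right 0)))))"
  by code_simp

text \<open>As for \<open>k = 1\<close>, each of the two trees has a single \<open>Found\<close>
  leaf: all other branches are closed by a threshold, so the window is forced letter by
  letter.\<close>

lemma certificate_2: "certifies 2 (91146554214600, 91131587562959) (14298511948561, 14296164072120)
    (Extend_left (Extend_left (Extend_right (Extend_right (Extend_left (Extend_right (Extend_left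
    (Extend_right (Extend_left (Extend_right (Extend_left (Extend_left (Extend_right (Extend_left
    (Extend_right Low (Extend_left Low (Extend_right (High_right 8) Low))) Low) Low) (Extend_right
    (High_right 0) Low)) Low) (Extend_left (High_right 0) (Extend_left Low (Extend_right (High_right
    6) Low)))) (High_right 0)) (High_right 1)) Low) (Extend_left (High_right 0) (Extend_right
    (High_right 4) (Extend_left Low (Extend_right Low (Extend_left (Extend_left (Extend_right
    (High_right 4) Low) (High_right 0)) Low)))))) (High_right 0)) (High_right 1)) (High_right 0))
    (Extend_right Low (Extend_left (High_left 3) (Extend_right (High_right 0) (Extend_left
    (Extend_right (Extend_left (Extend_right (Extend_left (Extend_right Low (Extend_left
    (Extend_right (High_right 6) Low) (High_right 0))) Low) Low) (High_left 4)) (High_right 0))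
    (Extend_right Low (Extend_left Low (Extend_right (Extend_right (Extend_left (Extend_right
    (High_right 0) (Extend_left (Extend_right (High_right 7) (Extend_left (High_right 0)
    (Extend_left (High_left 9) (Extend_right (High_right 0) (Extend_right (High_right 7)
    (Extend_left (High_right 0) (Extend_left (High_left 9) (Extend_right (High_right 0)
    (Extend_right (Extend_left (Extend_right (Extend_left (Extend_right Low (Extend_left (High_left
    12) Low)) (High_right 0)) (High_right 7)) Low) (Extend_left (High_right 0) (Extend_right
    (Extend_left Low (Extend_right (Extend_left (Extend_right (High_right 0) (Extend_left
    (Extend_right (High_right 15) (Extend_left (High_right 0) (Extend_left (High_left 17)
    (Extend_right (High_right 0) (Extend_right (High_right 15) (Extend_left (High_right 0)
    (Extend_left Low (Extend_right (Extend_right (Extend_left (High_right 0) (Extend_right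
    (High_right 0) (Extend_left (Extend_right Low (Extend_left (Extend_right (Extend_left (High_left
    21) (High_right 0)) (Extend_left Low (Extend_left (High_left 24) (Extend_right Low (Extend_right
    (Extend_left (High_left 21) (High_right 0)) (Extend_left Low (Extend_left (High_right 0)
    (Extend_right (Extend_right (Extend_left (Extend_right Low (Extend_left (Extend_right
    (High_right 28) (Extend_left Low (Extend_left (High_left 30) (Extend_right Low (Extend_right
    (High_right 28) (Extend_left Low (Extend_left (High_left 30) (Extend_right Low (Extend_right
    (Extend_left (High_left 21) (High_right 0)) (Extend_left Low (Extend_right (Extend_left
    (High_right 0) (Extend_right (Extend_left (Extend_right Low (Extend_left (Extend_right
    (High_right 36) (Extend_left Low (Extend_left (High_left 38) (Extend_right Low (Extend_right
    (High_right 36) (Extend_left Low (Extend_left (High_left 38) (Extend_right Low Found))))))))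
    Low)) (Extend_right (High_right 21) (High_right 0))) Low)) (High_right 0)))))))))))) Low))
    (Extend_right (High_right 21) (High_right 0))) Low) (High_right 0))))))))) Low)) (Extend_right
    (High_right 21) (High_right 0))))) (High_right 0)) Low)))))))) (High_right 0))) (Extend_right
    (High_right 12) Low)) (High_right 0))) Low))))))))))) (High_right 0))) (Extend_right (High_right
    4) Low)) (High_right 0)) Low)))))))) (High_right 0))
    (Extend_left (High_right 0) (Extend_left (High_left 17) (Extend_left (High_right 0) (Extend_left
    (High_left 17) (Extend_left (High_right 0) (Extend_left (Extend_left (Extend_left (High_left 21)
    (Extend_left (High_right 0) (Extend_left (High_left 21) (Extend_left (High_right 0) (Extend_left
    (Extend_left (Extend_left (High_left 21) (Extend_left (High_right 0) (Extend_left (High_left 21)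
    (Extend_left (High_right 0) (Extend_left (High_left 21) (Extend_left (High_right 0) (Extend_left
    (Extend_left Found (High_left 21)) (High_right 0)))))))) (High_left 21)) (High_right 0))))))
    (High_left 17)) (High_right 0)))))))"
  by code_simp

lemma certificate_3: "certifies 3 (3406021276908417373, 3406004811243089999) (560455293198765601, 560452583800162800)
    (Extend_left (Extend_left (Extend_right (Extend_right (Extend_left (Extend_right (Extend_left
    (Extend_right (Extend_left (Extend_right (Extend_left (Extend_left (Extend_right (Extend_left
    (Extend_right (Extend_left (Extend_right (Extend_left (Extend_right (Extend_left Low
    (Extend_right (Extend_right (Extend_left (High_right 0) (Extend_right (High_right 0)
    (Extend_left Low (High_left 12)))) (High_right 0)) Low)) (High_right 0)) (Extend_right Low
    (Extend_left Low (Extend_right (High_right 10) Low)))) Low) (Extend_right (High_right 0)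
    (High_right 1))) (High_right 0)) (Extend_right Low (Extend_left (High_left 9) (Extend_right
    (High_right 0) (Extend_left (Extend_right Low (High_right 8)) Low))))) Low) (Extend_right
    (High_right 0) (High_right 1))) Low) (Extend_left (High_right 0) (Extend_left (High_left 7)
    (Extend_right (High_right 0) (Extend_right (Extend_left (Extend_right (Extend_left (Extend_right
    Low (Extend_left (Extend_left Low (High_left 8)) Low)) (High_right 0)) Low) Low) (High_right
    6)))))) (High_right 0)) (High_right 1)) Low) (Extend_left (High_right 0) (Extend_right
    (High_right 4) (Extend_left Low (Extend_right (Extend_left (Extend_left (Extend_right
    (Extend_left (Extend_right (Extend_left (Extend_right (Extend_left (Extend_right Low
    (Extend_left Low (High_left 6))) Low) Low) (High_left 6)) (High_right 0)) (Extend_right Low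
    (Extend_right (High_right 8) Low))) Low) (High_left 6)) Low) (Extend_left (High_right 0)
    (High_left 5))))))) (High_right 0)) (High_right 1)) (High_right 0)) (Extend_right Low
    (Extend_left (High_left 3) (Extend_right (High_right 0) (Extend_left (Extend_right (Extend_left
    (Extend_right (Extend_left (Extend_right (High_right 3) (High_right 0)) (Extend_right Low
    (Extend_right (High_right 6) (Extend_left Low (Extend_left (Extend_right Low (Extend_left
    (Extend_right (High_right 6) Low) (High_right 0))) Low))))) Low) (High_left 4)) (High_right 0))
    (Extend_right Low (Extend_left (High_left 3) (Extend_right (High_right 0) (Extend_left
    (Extend_right (Extend_left (Extend_right (Extend_left (High_left 6) Low) Low) (High_left 6))
    (High_right 0)) (Extend_right Low (Extend_left Low (Extend_right (Extend_right (Extend_left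
    (Extend_right (High_right 0) (Extend_left (Extend_right (High_right 9) (Extend_left (High_right
    0) (Extend_left (High_left 11) (Extend_right (High_right 0) (Extend_right (High_right 9)
    (Extend_left (High_right 0) (Extend_left (High_left 11) (Extend_right (High_right 0)
    (Extend_right (High_right 9) (Extend_left (High_right 0) (Extend_left (High_left 11)
    (Extend_right (High_right 0) (Extend_right (Extend_left (Extend_right (Extend_left (Extend_right
    Low (Extend_left (High_left 16) Low)) (High_right 0)) (High_right 9)) Low) (Extend_left
    (High_right 0) (Extend_right (Extend_left Low (Extend_right (Extend_left (Extend_right
    (High_right 0) (Extend_left (Extend_right (High_right 19) (Extend_left (High_right 0)
    (Extend_left (High_left 21) (Extend_right (High_right 0) (Extend_right (High_right 19)
    (Extend_left (High_right 0) (Extend_left (High_left 21) (Extend_right (High_right 0)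
    (Extend_right (High_right 19) (Extend_left (High_right 0) (Extend_left Low (Extend_right
    (Extend_right (Extend_left (High_right 0) (Extend_right (High_right 0) (Extend_left
    (Extend_right Low (Extend_left (Extend_right (High_right 24) (Extend_left Low (Extend_left
    (High_left 30) (Extend_right Low (Extend_right (Extend_left (High_left 27) (High_right 0))
    (Extend_left Low (Extend_left (High_left 30) (Extend_right Low (Extend_right (Extend_left
    (High_left 27) (High_right 0)) (Extend_left Low (Extend_left (High_right 0) (Extend_right
    (Extend_right (Extend_left (Extend_right Low (Extend_left (Extend_right (High_right 36)
    (Extend_left Low (Extend_left (High_left 38) (Extend_right Low (Extend_right (High_right 36)
    (Extend_left Low (Extend_left (High_left 38) (Extend_right Low (Extend_right (High_right 36)
    (Extend_left Low (Extend_left (High_left 38) (Extend_right Low (Extend_right (Extend_left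
    (High_left 27) (High_right 0)) (Extend_left Low (Extend_right (Extend_left (High_right 0)
    (Extend_right (Extend_left (Extend_right Low (Extend_left (Extend_right (High_right 46)
    (Extend_left Low (Extend_left (High_left 48) (Extend_right Low (Extend_right (High_right 46)
    (Extend_left Low (Extend_left (High_left 48) (Extend_right Low (Extend_right (High_right 46)
    (Extend_left Low (Extend_left (High_left 48) (Extend_right Low Found)))))))))))) Low))
    (Extend_right (High_right 27) (High_right 0))) Low)) (High_right 0)))))))))))))))) Low))
    (Extend_right (High_right 27) (High_right 0))) Low) (High_right 0))))))))))))) Low))
    (Extend_right (High_right 27) (High_right 0))))) (High_right 0)) Low)))))))))))) (High_right
    0))) (Extend_right (High_right 16) Low)) (High_right 0))) Low))))))))))))))) (High_right 0)))
    (Extend_right (High_right 6) Low)) (High_right 0)) Low)))))))))))) (High_right 0))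
    (Extend_left (High_right 0) (Extend_left (High_left 21) (Extend_left (High_right 0) (Extend_left
    (High_left 21) (Extend_left (High_right 0) (Extend_left (High_left 21) (Extend_left (High_right
    0) (Extend_left (Extend_left (Extend_left (High_left 27) (Extend_left (High_right 0)
    (Extend_left (High_left 27) (Extend_left (High_right 0) (Extend_left (High_left 27) (Extend_left
    (High_right 0) (Extend_left (Extend_left (Extend_left (High_left 27) (Extend_left (High_right 0)
    (Extend_left (High_left 27) (Extend_left (High_right 0) (Extend_left (High_left 27) (Extend_left
    (High_right 0) (Extend_left (High_left 27) (Extend_left (High_right 0) (Extend_left (Extend_left
    Found (High_left 27)) (High_right 0)))))))))) (High_left 27)) (High_right 0)))))))) (High_left
    21)) (High_right 0)))))))))"
  by code_simp

lemma certificate_4: "certifies 4 (135303735948490571652616, 135303716693626624980719) (21970881873184540785841, 21970878746542557909480)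
    (Extend_left (Extend_left (Extend_right (Extend_right (Extend_left (Extend_right (Extend_left
    (Extend_right (Extend_left (Extend_right (Extend_left (Extend_left (Extend_right (Extend_left
    (Extend_right (Extend_left (Extend_right (Extend_left (Extend_right (Extend_left (Extend_right
    (Extend_left (Extend_right (Extend_left (Extend_right (Extend_left (Extend_right (Extend_left
    Low (Extend_right (Extend_right (Extend_left (High_left 16) Low) (High_right 0)) Low))
    (High_right 0)) (Extend_right Low Low)) Low) (Extend_right (High_right 0) (High_right 1)))
    (High_right 0)) (Extend_right Low (Extend_left (High_left 13) (Extend_right (High_right 0)
    Low)))) Low) (Extend_right (High_right 0) (High_right 1))) (High_right 0)) (Extend_right Low
    (Extend_left (High_left 11) (Extend_right (High_right 0) (Extend_left (Extend_right (Extend_left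
    Low (High_left 12)) (High_right 0)) (High_left 11)))))) Low) (Extend_right (High_right 0)
    (High_right 1))) (High_right 0)) (Extend_right Low (Extend_left (High_left 9) (Extend_right
    (High_right 0) (Extend_left (Extend_right (Extend_right (Extend_left (Extend_right (Extend_left
    (Extend_right (Extend_left Low (High_left 10)) Low) Low) (High_right 8)) (High_right 0))
    (High_right 9)) (High_right 0)) (High_left 9)))))) Low) (Extend_right (High_right 0) (High_right
    1))) Low) (Extend_left (High_right 0) (Extend_left (High_left 7) (Extend_right (High_right 0)
    (Extend_right (Extend_left (Extend_right (Extend_left (Extend_right (Extend_left (Extend_left
    (Extend_right (Extend_left (Extend_right (Extend_left Low (High_left 8)) (High_right 0))
    (Extend_right Low (Extend_left Low (Extend_right (High_right 12) Low)))) Low) (High_left 8))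
    Low) (Extend_left (High_right 0) (High_left 7))) (High_right 0)) (High_right 7)) Low)
    (High_right 6)))))) (High_right 0)) (High_right 1)) Low) (Extend_left (High_right 0)
    (Extend_right (High_right 4) (Extend_left Low (Extend_right (Extend_left (Extend_left
    (Extend_right (Extend_left (Extend_right (Extend_left (Extend_right (Extend_left (Extend_right
    (High_right 5) (High_right 0)) (Extend_right Low (Extend_left (High_left 11) (Extend_right
    (High_right 0) (Extend_left (Extend_right Low (High_right 10)) Low))))) Low) (High_left 6))
    (High_right 0)) (Extend_right Low (Extend_right (High_right 8) (Extend_left Low (Extend_left
    (Extend_right (Extend_left (Extend_right (Extend_left (Extend_right Low (Extend_left Low
    (High_left 10))) Low) Low) (High_left 10)) (High_right 0)) (High_left 5)))))) Low) (High_left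
    6)) Low) (Extend_left (High_right 0) (High_left 5))))))) (High_right 0)) (High_right 1))
    (High_right 0)) (Extend_right Low (Extend_left (High_left 3) (Extend_right (High_right 0)
    (Extend_left (Extend_right (Extend_left (Extend_right (Extend_left (Extend_right (High_right 3)
    (High_right 0)) (Extend_right Low (Extend_right (High_right 6) (Extend_left Low (Extend_left
    (Extend_right (Extend_left (Extend_right (Extend_left (Extend_right (High_right 3) (High_right
    0)) (Extend_right Low (Extend_left Low (Extend_right (High_right 10) Low)))) Low) (High_left 8))
    (High_right 0)) (Extend_right Low (Extend_left (High_left 7) (Extend_right (High_right 0)
    (Extend_left (Extend_right Low (Extend_left (Extend_right (High_right 6) Low) (High_right 0)))
    Low))))))))) Low) (High_left 4)) (High_right 0)) (Extend_right Low (Extend_left (High_left 3)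
    (Extend_right (High_right 0) (Extend_left (Extend_right (Extend_left (Extend_right (Extend_left
    (High_left 6) (Extend_right Low (Extend_left (High_left 9) (Extend_right (High_right 0)
    (Extend_left (Extend_right Low (Extend_left (Extend_right (High_right 8) Low) (High_right 0)))
    Low))))) Low) (High_left 6)) (High_right 0)) (Extend_right Low (Extend_left (High_left 3)
    (Extend_right (High_right 0) (Extend_left (Extend_right (Extend_left (Extend_right (Extend_left
    (High_left 8) Low) Low) (High_left 8)) (High_right 0)) (Extend_right Low (Extend_left Low
    (Extend_right (Extend_right (Extend_left (Extend_right (High_right 0) (Extend_left (Extend_right
    (High_right 11) (Extend_left (High_right 0) (Extend_left (High_left 13) (Extend_right
    (High_right 0) (Extend_right (High_right 11) (Extend_left (High_right 0) (Extend_left (High_left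
    13) (Extend_right (High_right 0) (Extend_right (High_right 11) (Extend_left (High_right 0)
    (Extend_left (High_left 13) (Extend_right (High_right 0) (Extend_right (High_right 11)
    (Extend_left (High_right 0) (Extend_left (High_left 13) (Extend_right (High_right 0)
    (Extend_right (Extend_left (Extend_right (Extend_left (Extend_right Low (Extend_left (High_left
    20) Low)) (High_right 0)) (High_right 11)) Low) (Extend_left (High_right 0) (Extend_right
    (Extend_left Low (Extend_right (Extend_left (Extend_right (High_right 0) (Extend_left
    (Extend_right (High_right 23) (Extend_left (High_right 0) (Extend_left (High_left 25)
    (Extend_right (High_right 0) (Extend_right (High_right 23) (Extend_left (High_right 0)
    (Extend_left (High_left 25) (Extend_right (High_right 0) (Extend_right (High_right 23)
    (Extend_left (High_right 0) (Extend_left (High_left 25) (Extend_right (High_right 0)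
    (Extend_right (High_right 23) (Extend_left (High_right 0) (Extend_left Low (Extend_right
    (Extend_right (Extend_left (High_right 0) (Extend_right (High_right 0) (Extend_left
    (Extend_right Low (Extend_left (Extend_right (High_right 30) (Extend_left Low (Extend_left
    (High_left 36) (Extend_right Low (Extend_right (High_right 30) (Extend_left Low (Extend_left
    (High_left 36) (Extend_right Low (Extend_right (Extend_left (High_left 33) (High_right 0))
    (Extend_left Low (Extend_left (High_left 36) (Extend_right Low (Extend_right (Extend_left
    (High_left 33) (High_right 0)) (Extend_left Low (Extend_left (High_right 0) (Extend_right
    (Extend_right (Extend_left (Extend_right Low (Extend_left (Extend_right (High_right 44)
    (Extend_left Low (Extend_left (High_left 46) (Extend_right Low (Extend_right (High_right 44)
    (Extend_left Low (Extend_left (High_left 46) (Extend_right Low (Extend_right (High_right 44)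
    (Extend_left Low (Extend_left (High_left 46) (Extend_right Low (Extend_right (High_right 44)
    (Extend_left Low (Extend_left (High_left 46) (Extend_right Low (Extend_right (Extend_left
    (High_left 33) (High_right 0)) (Extend_left Low (Extend_right (Extend_left (High_right 0)
    (Extend_right (Extend_left (Extend_right Low (Extend_left (Extend_right (High_right 56)
    (Extend_left Low (Extend_left (High_left 58) (Extend_right Low (Extend_right (High_right 56)
    (Extend_left Low (Extend_left (High_left 58) (Extend_right Low (Extend_right (High_right 56)
    (Extend_left Low (Extend_left (High_left 58) (Extend_right Low (Extend_right (High_right 56)
    (Extend_left Low (Extend_left (High_left 58) (Extend_right Low Found)))))))))))))))) Low))
    (Extend_right (High_right 33) (High_right 0))) Low)) (High_right 0)))))))))))))))))))) Low))
    (Extend_right (High_right 33) (High_right 0))) Low) (High_right 0))))))))))))))))) Low))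
    (Extend_right (High_right 33) (High_right 0))))) (High_right 0)) Low)))))))))))))))) (High_right
    0))) (Extend_right (High_right 20) Low)) (High_right 0))) Low))))))))))))))))))) (High_right
    0))) (Extend_right (High_right 8) Low)) (High_right 0)) Low)))))))))))))))) (High_right 0))
    (Extend_left (High_right 0) (Extend_left (High_left 25) (Extend_left (High_right 0) (Extend_left
    (High_left 25) (Extend_left (High_right 0) (Extend_left (High_left 25) (Extend_left (High_right
    0) (Extend_left (High_left 25) (Extend_left (High_right 0) (Extend_left (Extend_left
    (Extend_left (High_left 33) (Extend_left (High_right 0) (Extend_left (High_left 33) (Extend_left
    (High_right 0) (Extend_left (High_left 33) (Extend_left (High_right 0) (Extend_left (High_left
    33) (Extend_left (High_right 0) (Extend_left (Extend_left (Extend_left (High_left 33)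
    (Extend_left (High_right 0) (Extend_left (High_left 33) (Extend_left (High_right 0) (Extend_left
    (High_left 33) (Extend_left (High_right 0) (Extend_left (High_left 33) (Extend_left (High_right
    0) (Extend_left (High_left 33) (Extend_left (High_right 0) (Extend_left (Extend_left Found
    (High_left 33)) (High_right 0)))))))))))) (High_left 33)) (High_right 0)))))))))) (High_left
    25)) (High_right 0)))))))))))"
  by code_simp


theorem theorem1p1:
  shows "strict_antimono_on {1..} m_seq
    \<and> m_seq \<longlonglongrightarrow> 3
    \<and> (\<forall>k\<in>{1..4}. m_seq k \<in> markov_spectrum - lagrange_spectrum)
    \<and> inj_on (\<lambda>k. connected_component_set (UNIV - lagrange_spectrum) (m_seq k)) {1..4}"
proof (intro conjI)
  show "strict_antimono_on {1..} m_seq" by (rule strict_antimono_on_m_seq)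
  show "m_seq \<longlonglongrightarrow> 3" by (rule m_seq_tendsto_3)
  have not_L: "m_seq k \<notin> lagrange_spectrum" if "k \<in> {1..4}" for k
  proof -
    have "k = 1 \<or> k = 2 \<or> k = 3 \<or> k = 4" using that by auto
    then show ?thesis
      using certified_not_in_lagrange_spectrum certificate_1 certificate_2 certificate_3 certificate_4
      by (metis one_le_numeral le_refl)
  qed
  then show "\<forall>k\<in>{1..4}. m_seq k \<in> markov_spectrum - lagrange_spectrum"
    using m_seq_in_markov_spectrum by simp
  let ?C = "\<lambda>k. connected_component_set (UNIV - lagrange_spectrum) (m_seq k)"
  have "?C i \<noteq> ?C j" if "i \<in> {1..4}" "j \<in> {1..4}" "i < j" for i j
  proof
    assume "?C i = ?C j"
    moreover have "m_seq i \<in> ?C i" "m_seq j \<in> ?C j"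
      using not_L that by (auto simp: connected_component_refl_eq)
    ultimately have C: "m_seq i \<in> ?C i" "m_seq j \<in> ?C i" by auto
    \<comment> \<open>A component is an interval. If it contained \<open>m_seq j\<close> and
      \<open>m_seq i\<close>, it would contain \<open>omega_bar_value i\<close> between them, which
      lies in \<open>lagrange_spectrum\<close>.\<close>
    have "m_seq j \<le> m_seq (Suc i)"
      using strict_antimono_on_m_seq that by (cases "j = Suc i") (auto simp: monotone_on_def less_imp_le)
    then have "m_seq j \<le> omega_bar_value i" "omega_bar_value i \<le> m_seq i"
      using m_seq_Suc_less_omega_bar_value[of i] omega_bar_value_less_m_seq[of i] that by auto
    then have "omega_bar_value i \<in> ?C i"
      using C connected_connected_component[of "UNIV - lagrange_spectrum" "m_seq i"]
      unfolding is_interval_connected_1[symmetric] is_interval_1 by blast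
    then show False
      using connected_component_subset[of "UNIV - lagrange_spectrum" "m_seq i"]
        omega_bar_value_in_lagrange[of i] that by auto
  qed
  then show "inj_on ?C {1..4}"
    by (intro inj_onI) (metis linorder_neqE_nat)
qed

end
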